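(* Let $G$ be a finite graph with no loops and let $k$ be an odd positive integer. Then $|\mathrm{B}(G)|$ and $|\mathrm{B}(\Omega_k(G))|$ are $\mathbb{Z}_2$-homotopy equivalent. Moreover, the $\mathbb{Z}_2$-map $|p_k|\colon |\mathrm{B}(\Omega_k(G))|\to|\mathrm{B}(G)|$ induced by the homomorphism $p_k\colon\Omega_k(G)\to G$ is a $\mathbb{Z}_2$-homotopy equivalence.
   Context: A graph $G$ is a finite vertex set $V(G)$ with a symmetric adjacency relation (loops, i.e. a vertex adjacent to itself, are allowed). For $A,B\subseteq V(G)$ write $A\bowtie B$ if every vertex of $A$ is adjacent to every vertex of $B$; $N(v)$ is the set of neighbours of $v$ and $\mathrm{CN}(A)=\bigcap_{v\in A}N(v)$ (with $\mathrm{CN}(\emptyset)=V(G)$). A homomorphism $h\colon G\to H$ is a map $V(G)\to V(H)$ sending adjacent vertices to adjacent vertices. For $k=2\ell+1$, the graph $\Omega_k(G)$ has as vertices the tuples $\mathbf{A}=(A_0,\dots,A_\ell)$ of subsets of $V(G)$ with $|A_0|=1$ and $A_{i-1}\bowtie A_i$ for $i=1,\dots,\ell$; two such tuples $\mathbf{A},\mathbf{B}$ are adjacent iff $A_{i-1}\subseteq B_i$ and $B_{i-1}\subseteq A_i$ for $i=1,\dots,\ell$, and $A_\ell\bowtie B_\ell$. The homomorphism $p_k\colon\Omega_k(G)\to G$ sends $(\{v\},A_1,\dots,A_\ell)$ to $v$. Box complex: first delete isolated vertices of $G$. $\mathrm{B}(G)$ is the simplicial complex on vertex set $V(G)\times\{\circ,\bullet\}$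 (write $v^\circ,v^\bullet$), whose simplices are the nonempty sets $\sigma$ such that, writing $\sigma^\circ=\{v: v^\circ\in\sigma\}$ and $\sigma^\bullet=\{v:v^\bullet\in\sigma\}$, we have $\sigma^\circ\bowtie\sigma^\bullet$ and both $\mathrm{CN}(\sigma^\circ)$ and $\mathrm{CN}(\sigma^\bullet)$ are nonempty. Its $\mathbb{Z}_2$-action swaps $v^\circ\leftrightarrow v^\bullet$. $|\mathrm{B}(G)|$ is its geometric realization (the union of convex hulls of standard basis vectors $e_u$, $u$ in a simplex, in $\mathbb{R}^{V(\mathrm{B}(G))}$) with the induced linear $\mathbb{Z}_2$-action. A homomorphism $h\colon G\to H$ induces the $\mathbb{Z}_2$-map $|h|\colon|\mathrm{B}(G)|\to|\mathrm{B}(H)|$ obtained by extending $v^\circ\mapsto h(v)^\circ$, $v^\bullet\mapsto h(v)^\bullet$ linearly on simplices. A $\mathbb{Z}_2$-map between spaces with involutions is a continuous map commuting with the involutions. Two $\mathbb{Z}_2$-maps $f,g\colon X\to Y$ are $\mathbb{Z}_2$-homotopic if there is a continuous $H\colon[0,1]\times X\to Y$ with each $H(t,\cdot)$ a $\mathbb{Z}_2$-map, $H(0,\cdot)=f$, $H(1,\cdot)=g$. $X,Y$ are $\mathbb{Z}_2$-homotopy equivalent if there are $\mathbb{Z}_2$-maps $f\colon X\to Y$, $g\colon Y\to X$ with $g\circ f$ and $f\circ g$ $\mathbb{Z}_2$-homotopic to the identities; such $f$ is a $\mathbb{Z}_2$-homotopy equivalence. *)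

theory Defs
  imports "HOL-Analysis.Analysis" "HOL-Analysis.Finite_Function_Topology"
    "Graph_Theory.Pair_Digraph"
begin

section \<open>Graphs\<close>

text \<open>
  A finite graph, loops allowed, is a \<^locale>\<open>pair_pseudo_graph\<close>: a finite vertex set
  with a symmetric arc relation on it.  The locale \<^locale>\<open>pair_graph\<close> excludes loops.
\<close>

definition neighbours :: "'a pair_pre_digraph \<Rightarrow> 'a \<Rightarrow> 'a set" where
  "neighbours G v = {w \<in> pverts G. (v, w) \<in> parcs G}"

definition joined :: "'a pair_pre_digraph \<Rightarrow> 'a set \<Rightarrow> 'a set \<Rightarrow> bool" where
  "joined G A B \<longleftrightarrow> (\<forall>a\<in>A. \<forall>b\<in>B. (a, b) \<in> parcs G)"

text \<open>The intersection with the vertex set only matters for \<open>A = {}\<close>.\<close>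

definition common_neighbours :: "'a pair_pre_digraph \<Rightarrow> 'a set \<Rightarrow> 'a set" where
  "common_neighbours G A = pverts G \<inter> (\<Inter>v\<in>A. neighbours G v)"

definition graph_hom :: "'a pair_pre_digraph \<Rightarrow> 'b pair_pre_digraph \<Rightarrow> ('a \<Rightarrow> 'b) \<Rightarrow> bool" where
  "graph_hom G H h \<longleftrightarrow>
     (\<forall>v\<in>pverts G. h v \<in> pverts H) \<and> (\<forall>(u, v)\<in>parcs G. (h u, h v) \<in> parcs H)"

definition delete_isolated :: "'a pair_pre_digraph \<Rightarrow> 'a pair_pre_digraph" where
  "delete_isolated G =
     (let S = {v \<in> pverts G. neighbours G v \<noteq> {}}
      in \<lparr> pverts = S, parcs = parcs G \<inter> S \<times> S \<rparr>)"

section \<open>The graph \<open>\<Omega>\<^sub>k(G)\<close>\<close>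

text \<open>The tuple \<open>(A\<^sub>0, \<dots>, A\<^sub>l)\<close> is a list of length \<open>l + 1\<close>, where \<open>k = 2l + 1\<close>.\<close>

definition Omega_verts :: "nat \<Rightarrow> 'a pair_pre_digraph \<Rightarrow> 'a set list set" where
  "Omega_verts l G =
     {A. length A = l + 1 \<and> (\<forall>i\<le>l. A ! i \<subseteq> pverts G) \<and> card (A ! 0) = 1 \<and>
         (\<forall>i\<in>{1..l}. joined G (A ! (i - 1)) (A ! i))}"

definition Omega :: "nat \<Rightarrow> 'a pair_pre_digraph \<Rightarrow> 'a set list pair_pre_digraph" where
  "Omega k G =
     (let l = (k - 1) div 2
      in \<lparr> pverts = Omega_verts l G,
           parcs = {(A, B). A \<in> Omega_verts l G \<and> B \<in> Omega_verts l G \<and>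
             (\<forall>i\<in>{1..l}. A ! (i - 1) \<subseteq> B ! i \<and> B ! (i - 1) \<subseteq> A ! i) \<and>
             joined G (A ! l) (B ! l)} \<rparr>)"

text \<open>The projection \<open>p\<^sub>k\<close>; the same formula for all \<open>k\<close>.\<close>

definition Omega_proj :: "'a set list \<Rightarrow> 'a" where
  "Omega_proj A = the_elem (A ! 0)"

lemma joined_sym:
  assumes "pair_pseudo_graph G" and "joined G A B"
  shows "joined G B A"
proof -
  interpret pair_pseudo_graph G by fact
  show ?thesis using assms(2) arcs_symmetric unfolding joined_def by blast
qed

lemma finite_Omega_verts:
  assumes "finite (pverts G)"
  shows "finite (Omega_verts l G)"
proof (rule finite_subset)
  show "Omega_verts l G \<subseteq> {A. set A \<subseteq> Pow (pverts G) \<and> length A = l + 1}"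
    unfolding Omega_verts_def by (fastforce simp: in_set_conv_nth less_Suc_eq_le)
  show "finite {A. set A \<subseteq> Pow (pverts G) \<and> length A = l + 1}"
    using assms by (intro finite_lists_length_eq) simp
qed

lemma pair_pseudo_graph_Omega:
  assumes "pair_pseudo_graph G"
  shows "pair_pseudo_graph (Omega k G)"
proof -
  interpret G: pair_pseudo_graph G by fact
  let ?V = "pverts (Omega k G)" and ?E = "parcs (Omega k G)"
  have fin: "finite ?V"
    by (simp add: Omega_def Let_def finite_Omega_verts G.pair_finite_verts)
  have sub: "?E \<subseteq> ?V \<times> ?V"
    by (auto simp: Omega_def Let_def)
  have sym: "sym ?E"
    by (auto simp: Omega_def Let_def sym_def dest: joined_sym[OF assms])
  show ?thesis
  proof
    show "finite ?E" using fin sub by (meson finite_SigmaI finite_subset)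
  qed (use fin sub sym in \<open>auto simp: symmetric_def\<close>)
qed

lemma Omega_proj_eq:
  assumes "A \<in> Omega_verts l G"
  shows "A ! 0 = {Omega_proj A}"
  using assms unfolding Omega_verts_def Omega_proj_def
  by (metis (mono_tags, lifting) One_nat_def card_1_singletonE mem_Collect_eq the_elem_eq)

lemma graph_hom_Omega_proj:
  assumes "pair_pseudo_graph G"
  shows "graph_hom (Omega k G) G Omega_proj"
proof -
  define l where "l = (k - 1) div 2"
  have "Omega_proj A \<in> pverts G" if "A \<in> Omega_verts l G" for A
    using that Omega_proj_eq[OF that] unfolding Omega_verts_def by auto
  moreover have "(Omega_proj A, Omega_proj B) \<in> parcs G"
    if "A \<in> Omega_verts l G" "B \<in> Omega_verts l G"
      "\<forall>i\<in>{1..l}. A ! (i - 1) \<subseteq> B ! i \<and> B ! (i - 1) \<subseteq> A ! i" "joined G (A ! l) (B ! l)" for A B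
  proof (cases "l = 0")
    case True
    then show ?thesis
      using that Omega_proj_eq[OF that(1)] Omega_proj_eq[OF that(2)] by (simp add: joined_def)
  next
    case False
    then have one: "1 \<in> {1..l}" by simp
    have "\<forall>i\<in>{1..l}. joined G (A ! (i - 1)) (A ! i)"
      using that(1) by (simp add: Omega_verts_def)
    from bspec[OF this one] bspec[OF that(3) one]
    have "B ! 0 \<subseteq> A ! 1" and "joined G (A ! 0) (A ! 1)" by simp_all
    then show ?thesis
      using Omega_proj_eq[OF that(1)] Omega_proj_eq[OF that(2)] by (auto simp: joined_def)
  qed
  ultimately show ?thesis
    unfolding graph_hom_def Omega_def Let_def l_def by auto
qed

section \<open>Spaces with involution\<close>

record 'a Z2_space =
  Z2_top :: "'a topology"
  Z2_inv :: "'a \<Rightarrow> 'a"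

definition is_Z2_space :: "'a Z2_space \<Rightarrow> bool" where
  "is_Z2_space X \<longleftrightarrow> continuous_map (Z2_top X) (Z2_top X) (Z2_inv X) \<and>
     (\<forall>x\<in>topspace (Z2_top X). Z2_inv X (Z2_inv X x) = x)"

definition Z2_map :: "'a Z2_space \<Rightarrow> 'b Z2_space \<Rightarrow> ('a \<Rightarrow> 'b) \<Rightarrow> bool" where
  "Z2_map X Y f \<longleftrightarrow> continuous_map (Z2_top X) (Z2_top Y) f \<and>
     (\<forall>x\<in>topspace (Z2_top X). f (Z2_inv X x) = Z2_inv Y (f x))"

definition Z2_homotopic :: "'a Z2_space \<Rightarrow> 'b Z2_space \<Rightarrow> ('a \<Rightarrow> 'b) \<Rightarrow> ('a \<Rightarrow> 'b) \<Rightarrow> bool" where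
  "Z2_homotopic X Y f g \<longleftrightarrow> homotopic_with (Z2_map X Y) (Z2_top X) (Z2_top Y) f g"

definition Z2_homotopy_equivalence :: "'a Z2_space \<Rightarrow> 'b Z2_space \<Rightarrow> ('a \<Rightarrow> 'b) \<Rightarrow> bool" where
  "Z2_homotopy_equivalence X Y f \<longleftrightarrow> Z2_map X Y f \<and>
     (\<exists>g. Z2_map Y X g \<and> Z2_homotopic X X (g \<circ> f) id \<and> Z2_homotopic Y Y (f \<circ> g) id)"

definition Z2_homotopy_equivalent :: "'a Z2_space \<Rightarrow> 'b Z2_space \<Rightarrow> bool" where
  "Z2_homotopy_equivalent X Y \<longleftrightarrow> (\<exists>f. Z2_homotopy_equivalence X Y f)"

section \<open>Geometric realization\<close>

text \<open>
  Points are finitely supported functions \<open>'v \<Rightarrow>\<^sub>0 real\<close>, with the library's norm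
  (the sum of the absolute values of the coordinates).  If \<open>V\<close> is finite, the functions
  supported on \<open>V\<close> form a copy of \<open>\<real>\<^sup>V\<close> with its usual topology.
\<close>

definition basis_vec :: "'v \<Rightarrow> ('v \<Rightarrow>\<^sub>0 real)" where
  "basis_vec u = Poly_Mapping.single u 1"

definition realization :: "'v set set \<Rightarrow> ('v \<Rightarrow>\<^sub>0 real) set" where
  "realization K = (\<Union>\<sigma>\<in>K. convex hull (basis_vec ` \<sigma>))"

text \<open>The linear map sending the basis vector at \<open>u\<close> to the basis vector at \<open>\<phi> u\<close>.\<close>

definition linear_ext :: "('v \<Rightarrow> 'w) \<Rightarrow> ('v \<Rightarrow>\<^sub>0 real) \<Rightarrow> ('w \<Rightarrow>\<^sub>0 real)" where
  "linear_ext \<phi> x = (\<Sum>u\<in>Poly_Mapping.keys x. Poly_Mapping.lookup x u *\<^sub>R basis_vec (\<phi> u))"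

lemma lookup_scaleR_poly [simp]:
  "Poly_Mapping.lookup (r *\<^sub>R (x :: 'v \<Rightarrow>\<^sub>0 real)) u = r * Poly_Mapping.lookup x u"
proof -
  have "finite {i. r * Poly_Mapping.lookup x i \<noteq> 0}"
    by (rule finite_subset[OF _ finite_keys[of x]]) (auto simp: in_keys_iff)
  then show ?thesis
    by (simp add: scaleR_poly_mapping_def lookup_Abs_poly_mapping)
qed

lemma linear_ext_superset:
  assumes "finite S" and "Poly_Mapping.keys x \<subseteq> S"
  shows "linear_ext \<phi> x = (\<Sum>u\<in>S. Poly_Mapping.lookup x u *\<^sub>R basis_vec (\<phi> u))"
  unfolding linear_ext_def using assms
  by (intro sum.mono_neutral_left) (auto simp: in_keys_iff)

lemma linear_linear_ext: "linear (linear_ext \<phi>)"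
proof (rule linearI)
  fix x y :: "'a \<Rightarrow>\<^sub>0 real" and r :: real
  let ?S = "Poly_Mapping.keys x \<union> Poly_Mapping.keys y"
  have "Poly_Mapping.keys (x + y) \<subseteq> ?S" by (rule keys_add)
  then show "linear_ext \<phi> (x + y) = linear_ext \<phi> x + linear_ext \<phi> y"
    by (simp add: linear_ext_superset[where S = ?S] lookup_add scaleR_add_left sum.distrib)
  have "Poly_Mapping.keys (r *\<^sub>R x) \<subseteq> Poly_Mapping.keys x" by (auto simp: in_keys_iff)
  then show "linear_ext \<phi> (r *\<^sub>R x) = r *\<^sub>R linear_ext \<phi> x"
    by (simp add: linear_ext_superset[where S = "Poly_Mapping.keys x"] scaleR_sum_right)
qed

lemma linear_ext_basis [simp]: "linear_ext \<phi> (basis_vec u) = basis_vec (\<phi> u)"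
  by (simp add: linear_ext_def basis_vec_def)

lemma basis_expansion: "x = (\<Sum>u\<in>Poly_Mapping.keys x. Poly_Mapping.lookup x u *\<^sub>R basis_vec u)"
  by (rule poly_mapping_eqI)
    (simp add: lookup_sum basis_vec_def lookup_single when_def mult_delta_right in_keys_iff)

lemma linear_ext_comp: "linear_ext \<psi> (linear_ext \<phi> x) = linear_ext (\<psi> \<circ> \<phi>) x"
  unfolding linear_ext_def[of \<phi>] linear_ext_def[of "\<psi> \<circ> \<phi>"]
  by (simp add: linear_sum[OF linear_linear_ext] linear_cmul[OF linear_linear_ext])

lemma linear_ext_id: "linear_ext (\<lambda>u. u) x = x"
  unfolding linear_ext_def by (rule basis_expansion[symmetric])

lemma continuous_on_linear_ext: "continuous_on S (linear_ext \<phi>)"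
proof -
  have nb: "norm (basis_vec v) = 1" for v :: 'b
    by (simp add: norm_poly_mapping_def dist_poly_mapping_def basis_vec_def)
  have "norm (linear_ext \<phi> x) \<le> norm x * 1" for x
  proof -
    have "norm (linear_ext \<phi> x) \<le> (\<Sum>u\<in>Poly_Mapping.keys x. \<bar>Poly_Mapping.lookup x u\<bar>)"
      unfolding linear_ext_def by (rule order_trans[OF norm_sum]) (simp add: nb)
    then show ?thesis by (simp add: norm_poly_mapping_def dist_poly_mapping_def)
  qed
  then have "bounded_linear (linear_ext \<phi>)"
    by (intro bounded_linear_intro[where K = 1])
      (auto simp: linear_add[OF linear_linear_ext] linear_cmul[OF linear_linear_ext])
  then show ?thesis by (rule linear_continuous_on)
qed

lemma linear_ext_realization:
  assumes "\<And>\<sigma>. \<sigma> \<in> K \<Longrightarrow> \<phi> ` \<sigma> \<in> L" and "x \<in> realization K"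
  shows "linear_ext \<phi> x \<in> realization L"
proof -
  obtain \<sigma> where "\<sigma> \<in> K" and x: "x \<in> convex hull (basis_vec ` \<sigma>)"
    using assms(2) unfolding realization_def by blast
  have "linear_ext \<phi> x \<in> convex hull (linear_ext \<phi> ` basis_vec ` \<sigma>)"
    using x convex_hull_linear_image[OF linear_linear_ext] by blast
  also have "linear_ext \<phi> ` basis_vec ` \<sigma> = basis_vec ` \<phi> ` \<sigma>"
    by (simp add: image_image)
  finally show ?thesis using assms(1)[OF \<open>\<sigma> \<in> K\<close>] unfolding realization_def by blast
qed

section \<open>The box complex\<close>

text \<open>The vertices \<open>(v, White)\<close> and \<open>(v, Black)\<close> are \<open>v\<close> marked with an open and with
  a filled circle, respectively.\<close>

datatype colour = White | Black

primrec flip :: "colour \<Rightarrow> colour" where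
  "flip White = Black"
| "flip Black = White"

definition shore :: "colour \<Rightarrow> ('a \<times> colour) set \<Rightarrow> 'a set" where
  "shore c \<sigma> = {v. (v, c) \<in> \<sigma>}"

definition box_complex :: "'a pair_pre_digraph \<Rightarrow> ('a \<times> colour) set set" where
  "box_complex G =
     (let H = delete_isolated G
      in {\<sigma>. \<sigma> \<noteq> {} \<and> \<sigma> \<subseteq> pverts H \<times> UNIV \<and>
             joined H (shore White \<sigma>) (shore Black \<sigma>) \<and>
             common_neighbours H (shore White \<sigma>) \<noteq> {} \<and>
             common_neighbours H (shore Black \<sigma>) \<noteq> {}})"

definition box_space :: "'a pair_pre_digraph \<Rightarrow> ('a \<times> colour \<Rightarrow>\<^sub>0 real) Z2_space" where
  "box_space G = \<lparr> Z2_top = top_of_set (realization (box_complex G)),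
                   Z2_inv = linear_ext (map_prod id flip) \<rparr>"

definition box_map :: "('a \<Rightarrow> 'b) \<Rightarrow> ('a \<times> colour \<Rightarrow>\<^sub>0 real) \<Rightarrow> ('b \<times> colour \<Rightarrow>\<^sub>0 real)" where
  "box_map h = linear_ext (map_prod h id)"

lemma flip_flip [simp]: "flip (flip c) = c"
  by (cases c) auto

lemma shore_flip [simp]: "shore c (map_prod id flip ` \<sigma>) = shore (flip c) \<sigma>"
proof -
  have "(v, c) = map_prod id flip p \<longleftrightarrow> p = (v, flip c)" for v :: 'a and p
    by (cases p) auto
  then show ?thesis by (simp add: shore_def image_iff)
qed

lemma shore_map [simp]: "shore c (map_prod h id ` \<sigma>) = h ` shore c \<sigma>"
  by (force simp: shore_def)

lemma joined_delete_isolated_sym: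
  assumes "pair_pseudo_graph G" and "joined (delete_isolated G) A B"
  shows "joined (delete_isolated G) B A"
proof -
  interpret pair_pseudo_graph G by fact
  show ?thesis using assms(2) arcs_symmetric unfolding joined_def delete_isolated_def Let_def by auto
qed

lemma flip_box_complex:
  assumes "pair_pseudo_graph G" and "\<sigma> \<in> box_complex G"
  shows "map_prod id flip ` \<sigma> \<in> box_complex G"
proof -
  have "map_prod id flip ` \<sigma> \<subseteq> pverts (delete_isolated G) \<times> UNIV"
    using assms(2) by (auto simp: box_complex_def Let_def)
  then show ?thesis
    using assms(2) joined_delete_isolated_sym[OF assms(1)] by (auto simp: box_complex_def Let_def)
qed

lemma is_Z2_space_box_space:
  assumes "pair_pseudo_graph G"
  shows "is_Z2_space (box_space G)"
proof -
  have "map_prod id flip \<circ> map_prod id flip = (\<lambda>u::'a \<times> colour. u)"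
    by (auto simp: fun_eq_iff)
  then have "linear_ext (map_prod id flip) (linear_ext (map_prod id flip) x) = x"
    for x :: "'a \<times> colour \<Rightarrow>\<^sub>0 real"
    by (simp add: linear_ext_comp linear_ext_id)
  then show ?thesis
    using linear_ext_realization[OF flip_box_complex[OF assms]]
    by (auto simp: is_Z2_space_def box_space_def continuous_on_linear_ext)
qed

lemma graph_hom_delete_isolated:
  assumes "graph_hom G H h"
  shows "graph_hom (delete_isolated G) (delete_isolated H) h"
  using assms by (auto simp: graph_hom_def delete_isolated_def neighbours_def Let_def)

lemma common_neighbours_hom:
  assumes "graph_hom G H h" and "common_neighbours G A \<noteq> {}"
  shows "common_neighbours H (h ` A) \<noteq> {}"
proof -
  obtain w where "w \<in> common_neighbours G A" using assms(2) by blast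
  then have "h w \<in> common_neighbours H (h ` A)"
    using assms(1) by (auto simp: common_neighbours_def neighbours_def graph_hom_def)
  then show ?thesis by blast
qed

lemma hom_box_complex:
  assumes "graph_hom G H h" and "\<sigma> \<in> box_complex G"
  shows "map_prod h id ` \<sigma> \<in> box_complex H"
proof -
  note hom = graph_hom_delete_isolated[OF assms(1)]
  have "joined (delete_isolated H) (h ` A) (h ` B)" if "joined (delete_isolated G) A B" for A B
    using that hom by (auto simp: joined_def graph_hom_def)
  moreover have "map_prod h id ` \<sigma> \<subseteq> pverts (delete_isolated H) \<times> UNIV"
    using assms(2) hom by (auto simp: box_complex_def Let_def graph_hom_def)
  ultimately show ?thesis
    using assms(2) common_neighbours_hom[OF hom] by (auto simp: box_complex_def Let_def)
qed

lemma Z2_map_box_map: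
  assumes "graph_hom G H h"
  shows "Z2_map (box_space G) (box_space H) (box_map h)"
proof -
  have "map_prod h id \<circ> map_prod id flip = map_prod id flip \<circ> map_prod h id"
    by (auto simp: fun_eq_iff)
  then have "box_map h (linear_ext (map_prod id flip) x) = linear_ext (map_prod id flip) (box_map h x)"
    for x by (simp only: box_map_def linear_ext_comp)
  then show ?thesis
    using linear_ext_realization[OF hom_box_complex[OF assms]]
    by (auto simp: Z2_map_def box_space_def box_map_def continuous_on_linear_ext)
qed

end

theory Submission
  imports Defs
begin

text \<open>
  Everything rests on carriers.  If every simplex \<open>\<sigma>\<close> of a finite complex \<open>K\<close> with free involution
  is assigned, monotonically and equivariantly, a contractible subcomplex \<open>\<Phi> \<sigma>\<close> of \<open>M\<close>, then there
  is a \<open>\<int>\<^sub>2\<close>-map \<open>|K| \<rightarrow> |M|\<close> carried by \<open>\<Phi>\<close>, unique up to \<open>\<int>\<^sub>2\<close>-homotopy: extend over one orbit of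
  simplices at a time.  So maps carried by suitable carriers in both directions are inverse
  equivalences.

  Let \<open>k = 2l + 1\<close> with \<open>l > 0\<close>, let \<open>X\<close> be the poset of simplices of \<open>B(G)\<close> with both shores
  nonempty, and let \<open>q\<close> send a simplex of \<open>B(\<Omega>\<^sub>k(G))\<close> to the union of all entries of its vertices, the
  entry \<open>A\<^sub>i\<close> being coloured with the parity of \<open>i\<close>; \<open>q\<close> takes values in \<open>X\<close>.
  The fibres \<open>{\<tau>. q \<tau> \<subseteq> x}\<close> are contractible: enlarge the entries to the shores of \<open>x\<close>, from the
  last one to the first.  Hence \<open>|B(\<Omega>\<^sub>k(G))|\<close> is equivalent to the order complex of \<open>X\<close>, which is
  equivalent to the barycentric subdivision of \<open>B(G)\<close> because \<open>X\<close> is contractible above every simplex.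
  The composite equivalence is carried by the full simplices \<open>q \<tau>\<close>, and so is \<open>|p\<^sub>k|\<close>, since
  \<open>p\<^sub>k\<close> maps \<open>\<tau>\<close> into \<open>q \<tau>\<close>.
\<close>

section \<open>Extending maps over a simplex\<close>

abbreviation supp :: "('v \<Rightarrow>\<^sub>0 real) \<Rightarrow> 'v set" where
  "supp \<equiv> Poly_Mapping.keys"

abbreviation coord :: "('v \<Rightarrow>\<^sub>0 real) \<Rightarrow> 'v \<Rightarrow> real" where
  "coord \<equiv> Poly_Mapping.lookup"

lemma coord_basis_vec [simp]: "coord (basis_vec u) v = (if v = u then 1 else 0)"
  by (simp add: basis_vec_def lookup_single when_def)

lemma abs_coord_le_norm: "\<bar>coord x u\<bar> \<le> norm x"
proof (cases "u \<in> supp x")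
  case True
  then have "\<bar>coord x u\<bar> \<le> (\<Sum>u\<in>supp x. \<bar>coord x u\<bar>)"
    by (intro member_le_sum) auto
  then show ?thesis by (simp add: norm_poly_mapping_def dist_poly_mapping_def)
qed (simp add: in_keys_iff)

lemma continuous_on_coord [continuous_intros]:
  assumes "continuous_on S f"
  shows "continuous_on S (\<lambda>x. coord (f x) u)"
proof -
  have "bounded_linear (\<lambda>x :: 'b \<Rightarrow>\<^sub>0 real. coord x u)"
    by (intro bounded_linear_intro[where K = 1]) (auto simp: lookup_add abs_coord_le_norm)
  from bounded_linear.continuous_on[OF this assms] show ?thesis .
qed

lemma sum_basis_vec:
  assumes "finite S" and "supp x \<subseteq> S"
  shows "(\<Sum>u\<in>S. coord x u *\<^sub>R basis_vec u) = x"
  using linear_ext_superset[OF assms, of "\<lambda>u. u"] by (simp add: linear_ext_id)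

text \<open>Basis vectors are affinely independent, so a point of a simplex is the same as its
  barycentric coordinates. The later arguments work with coordinates and supports instead of convex
  combinations.\<close>

lemma convex_hull_basis:
  assumes "finite \<sigma>"
  shows "convex hull (basis_vec ` \<sigma>) =
    {x. supp x \<subseteq> \<sigma> \<and> (\<forall>u. 0 \<le> coord x u) \<and> (\<Sum>u\<in>\<sigma>. coord x u) = 1}" (is "_ = ?R")
proof
  have "convex ?R"
    unfolding convex_def
    by (auto simp: lookup_add sum.distrib sum_distrib_left[symmetric]
          in_keys_iff subset_iff) (metis add_0 mult_zero_right)
  moreover have "basis_vec ` \<sigma> \<subseteq> ?R"
    using assms by (auto simp: in_keys_iff split: if_splits)
  ultimately show "convex hull (basis_vec ` \<sigma>) \<subseteq> ?R" by (rule hull_minimal[rotated])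
  show "?R \<subseteq> convex hull (basis_vec ` \<sigma>)"
  proof
    fix x assume x: "x \<in> ?R"
    have "(\<Sum>u\<in>\<sigma>. coord x u *\<^sub>R basis_vec u) \<in> convex hull (basis_vec ` \<sigma>)"
      using x assms by (intro convex_sum) (auto intro: hull_inc)
    then show "x \<in> convex hull (basis_vec ` \<sigma>)" using x assms by (simp add: sum_basis_vec)
  qed
qed

lemma continuous_on_Min_coord:
  fixes X :: "('v \<Rightarrow>\<^sub>0 real) set"
  assumes "finite \<sigma>" and "\<sigma> \<noteq> {}"
  shows "continuous_on X (\<lambda>x. Min (coord x ` \<sigma>))"
  using assms
proof (induction rule: finite_ne_induct)
  case (singleton u)
  then show ?case by (simp add: continuous_on_coord)
next
  case (insert u F)
  then show ?case by (simp add: continuous_on_min continuous_on_coord)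
qed

text \<open>The simplex is foliated by the segments from its boundary to its barycentre.  A map on
  the boundary is extended by running through the contraction on the outer half of each
  segment; on the inner half it is constant, so that continuity at the barycentre is free.\<close>

lemma simplex_extension:
  fixes f0 :: "('v \<Rightarrow>\<^sub>0 real) \<Rightarrow> 'b :: topological_space"
  assumes fin: "finite \<sigma>" and ne: "\<sigma> \<noteq> {}" and S: "contractible S" "S \<noteq> {}"
    and cont: "continuous_on {x \<in> convex hull (basis_vec ` \<sigma>). supp x \<noteq> \<sigma>} f0"
    and into: "\<And>x. x \<in> convex hull (basis_vec ` \<sigma>) \<Longrightarrow> supp x \<noteq> \<sigma> \<Longrightarrow> f0 x \<in> S"
  obtains F where "continuous_on (convex hull (basis_vec ` \<sigma>)) F"
    and "\<And>x. x \<in> convex hull (basis_vec ` \<sigma>) \<Longrightarrow> F x \<in> S"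
    and "\<And>x. x \<in> convex hull (basis_vec ` \<sigma>) \<Longrightarrow> supp x \<noteq> \<sigma> \<Longrightarrow> F x = f0 x"
proof -
  let ?T = "convex hull (basis_vec ` \<sigma>)"
  obtain h a where conth: "continuous_on ({0..1::real} \<times> S) h"
    and hS: "h ` ({0..1} \<times> S) \<subseteq> S" and h0: "\<And>x. h (0, x) = x" and h1: "\<And>x. h (1, x) = a"
    using S(1) by (auto simp: contractible_def homotopic_with_def image_subset_iff_funcset)
  have aS: "a \<in> S"
  proof -
    obtain s where "s \<in> S" using S(2) by blast
    then have "h (1, s) \<in> S" using hS by fastforce
    then show ?thesis by (simp add: h1)
  qed
  define n where "n = real (card \<sigma>)"
  have n: "n > 0" using fin ne by (simp add: n_def card_gt_0_iff)
  \<comment> \<open>\<open>m\<close> is 0 on the boundary and \<open>1 / n\<close> at the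
    barycentre, which is \<open>b\<close> divided by \<open>n\<close>. The point \<open>y x\<close>
    is the projection of \<open>x\<close> from the barycentre to the boundary: \<open>x\<close>
    combines \<open>y x\<close> and the barycentre with weights \<open>1 - n * m x\<close> and
    \<open>n * m x\<close>.\<close>
  define m where "m x = Min (coord x ` \<sigma>)" for x :: "'v \<Rightarrow>\<^sub>0 real"
  define b :: "'v \<Rightarrow>\<^sub>0 real" where "b = (\<Sum>u\<in>\<sigma>. basis_vec u)"
  have cb: "coord b u = (if u \<in> \<sigma> then 1 else 0)" for u
    unfolding b_def using fin by (simp add: lookup_sum sum.delta)
  define y where "y x = (1 / (1 - n * m x)) *\<^sub>R (x - m x *\<^sub>R b)" for x
  have contm: "continuous_on X m" for X
    unfolding m_def by (rule continuous_on_Min_coord[OF fin ne])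
  have m_le: "m x \<le> coord x u" if "u \<in> \<sigma>" for x u
    unfolding m_def using fin that by simp
  have m_nonneg: "m x \<ge> 0" if "x \<in> ?T" for x
    unfolding m_def using fin ne that by (simp add: convex_hull_basis)
  have m_bd: "m x = 0" if bd: "x \<in> ?T" "supp x \<noteq> \<sigma>" for x
  proof -
    obtain u where "u \<in> \<sigma>" "coord x u = 0"
      using bd by (auto simp: convex_hull_basis[OF fin] in_keys_iff)
    then show ?thesis using m_le[of u x] m_nonneg[OF bd(1)] by simp
  qed
  have ybd: "y x \<in> ?T \<and> supp (y x) \<noteq> \<sigma>" if x: "x \<in> ?T" and m: "n * m x < 1" for x
  proof -
    have c: "coord (y x) u = (if u \<in> \<sigma> then (coord x u - m x) / (1 - n * m x) else 0)" for u
      using x by (auto simp: y_def lookup_minus cb convex_hull_basis[OF fin] in_keys_iff)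
    have "m x \<in> coord x ` \<sigma>" unfolding m_def using fin ne by (intro Min_in) auto
    then obtain u where u: "u \<in> \<sigma>" "coord x u = m x" by auto
    then have "coord (y x) u = 0" by (simp add: c)
    with u have "supp (y x) \<noteq> \<sigma>" by (auto simp: in_keys_iff)
    moreover have "(\<Sum>u\<in>\<sigma>. coord (y x) u) = (\<Sum>u\<in>\<sigma>. coord x u - m x) / (1 - n * m x)"
      by (simp add: c sum_divide_distrib)
    moreover have "(\<Sum>u\<in>\<sigma>. coord x u - m x) = 1 - n * m x"
      using x by (simp add: sum_subtractf convex_hull_basis[OF fin] n_def)
    moreover have "0 \<le> coord (y x) u" for u
      using m m_le[of u x] by (simp add: c)
    moreover have "supp (y x) \<subseteq> \<sigma>" by (auto simp: in_keys_iff c split: if_splits)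
    ultimately show ?thesis using m by (simp add: convex_hull_basis[OF fin])
  qed
  \<comment> \<open>The factor 2 ends the contraction halfway, so \<open>y\<close> is used only away
    from the barycentre, where its denominator vanishes.\<close>
  define F where "F x = (if 2 * n * m x \<le> 1 then h (2 * n * m x, f0 (y x)) else a)" for x
  have seg: "2 * n * m x \<in> {0..1}" if "x \<in> ?T" "2 * n * m x \<le> 1" for x
    using that m_nonneg[of x] n by simp
  have ybd2: "y x \<in> ?T \<and> supp (y x) \<noteq> \<sigma>" if "x \<in> ?T" "2 * n * m x \<le> 1" for x
    using ybd[OF that(1)] that m_nonneg[OF that(1)] n by fastforce
  have conty: "continuous_on {x \<in> ?T. 2 * n * m x \<le> 1} y"
    unfolding y_def by (intro continuous_intros contm) auto
  have "continuous_on {x \<in> ?T. 2 * n * m x \<le> 1} (\<lambda>x. f0 (y x))"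
    by (rule continuous_on_compose2[OF cont conty]) (use ybd2 in blast)
  then have "continuous_on {x \<in> ?T. 2 * n * m x \<le> 1} (\<lambda>x. (2 * n * m x, f0 (y x)))"
    by (intro continuous_intros contm)
  then have c1: "continuous_on {x \<in> ?T. 2 * n * m x \<le> 1} (\<lambda>x. h (2 * n * m x, f0 (y x)))"
    by (rule continuous_on_compose2[OF conth]) (use seg ybd2 into in blast)
  have "continuous_on ?T F"
    unfolding F_def
    by (rule continuous_on_cases_le[OF c1]) (auto simp: h1 intro!: continuous_intros contm)
  moreover have "F x \<in> S" if x: "x \<in> ?T" for x
  proof (cases "2 * n * m x \<le> 1")
    case True
    then have "f0 (y x) \<in> S" using ybd2[OF x] into by simp
    then show ?thesis using seg[OF x True] True hS unfolding F_def by auto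
  qed (simp add: F_def aS)
  moreover have "F x = f0 x" if "x \<in> ?T" "supp x \<noteq> \<sigma>" for x
    by (simp add: F_def m_bd[OF that] y_def h0)
  ultimately show ?thesis by (rule that)
qed

section \<open>Equivariant carriers\<close>

definition finite_complex :: "'v set set \<Rightarrow> bool" where
  "finite_complex K \<longleftrightarrow> finite K \<and>
     (\<forall>\<sigma>\<in>K. finite \<sigma> \<and> \<sigma> \<noteq> {} \<and> (\<forall>\<rho>\<subseteq>\<sigma>. \<rho> \<noteq> {} \<longrightarrow> \<rho> \<in> K))"

text \<open>The support of a fixed point of the realization would be an invariant simplex.\<close>

definition free_involution :: "'v set set \<Rightarrow> ('v \<Rightarrow> 'v) \<Rightarrow> bool" where
  "free_involution K \<nu> \<longleftrightarrow> (\<forall>v. \<nu> (\<nu> v) = v) \<and> (\<forall>\<sigma>\<in>K. \<nu> ` \<sigma> \<in> K \<and> \<nu> ` \<sigma> \<noteq> \<sigma>)"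

definition realization_space :: "'v set set \<Rightarrow> ('v \<Rightarrow> 'v) \<Rightarrow> ('v \<Rightarrow>\<^sub>0 real) Z2_space" where
  "realization_space K \<nu> = \<lparr> Z2_top = top_of_set (realization K), Z2_inv = linear_ext \<nu> \<rparr>"

text \<open>The support of a point is the smallest simplex containing it. It belongs to
  \<open>K\<close> because \<open>K\<close> is closed under nonempty faces and coordinates with sum
  1 cannot all vanish.\<close>

lemma realization_iff:
  assumes "finite_complex K"
  shows "x \<in> realization K \<longleftrightarrow>
    supp x \<in> K \<and> (\<forall>u. 0 \<le> coord x u) \<and> (\<Sum>u\<in>supp x. coord x u) = 1"
proof
  assume "x \<in> realization K"
  then obtain \<sigma> where \<sigma>: "\<sigma> \<in> K" "x \<in> convex hull (basis_vec ` \<sigma>)"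
    unfolding realization_def by blast
  have fin: "finite \<sigma>" using \<sigma>(1) assms by (simp add: finite_complex_def)
  have x: "supp x \<subseteq> \<sigma>" "\<forall>u. 0 \<le> coord x u" "(\<Sum>u\<in>\<sigma>. coord x u) = 1"
    using \<sigma>(2) by (auto simp: convex_hull_basis[OF fin])
  then have "(\<Sum>u\<in>supp x. coord x u) = 1"
    using fin by (subst sum.mono_neutral_left[of \<sigma>]) (auto simp: in_keys_iff)
  moreover from this have "supp x \<noteq> {}" by auto
  ultimately show "supp x \<in> K \<and> (\<forall>u. 0 \<le> coord x u) \<and> (\<Sum>u\<in>supp x. coord x u) = 1"
    using x \<sigma>(1) assms by (simp add: finite_complex_def)
next
  assume "supp x \<in> K \<and> (\<forall>u. 0 \<le> coord x u) \<and> (\<Sum>u\<in>supp x. coord x u) = 1"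
  then show "x \<in> realization K"
    unfolding realization_def by (auto simp: convex_hull_basis intro!: bexI[of _ "supp x"])
qed

lemma realization_mono: "K \<subseteq> L \<Longrightarrow> realization K \<subseteq> realization L"
  unfolding realization_def by blast

lemma in_hull_supp:
  assumes "finite_complex K" and "x \<in> realization K"
  shows "x \<in> realization {supp x}"
  using assms by (simp add: realization_iff) (simp add: realization_def convex_hull_basis)

lemma linear_ext_in_realization:
  assumes "finite_complex K" and "x \<in> realization K" and "\<phi> ` supp x \<in> M"
  shows "linear_ext \<phi> x \<in> realization M"
  using linear_ext_realization[OF _ in_hull_supp[OF assms(1,2)], of \<phi> M] assms(3) by simp

lemma closed_realization:
  assumes "finite_complex K"
  shows "closed (realization K)"
  unfolding realization_def using assms
  by (intro closed_UN ballI compact_imp_closed[OF finite_imp_compact_convex_hull])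
    (auto simp: finite_complex_def)

lemma linear_ext_invol:
  assumes "\<And>v. \<nu> (\<nu> v) = v"
  shows "linear_ext \<nu> (linear_ext \<nu> x) = x"
proof -
  have "\<nu> \<circ> \<nu> = (\<lambda>v. v)" using assms by (simp add: fun_eq_iff)
  then show ?thesis by (simp add: linear_ext_comp linear_ext_id)
qed

lemma coord_linear_ext_invol:
  assumes "\<And>v. \<nu> (\<nu> v) = v"
  shows "coord (linear_ext \<nu> x) v = coord x (\<nu> v)"
proof -
  have "v = \<nu> u \<longleftrightarrow> u = \<nu> v" for u using assms by metis
  then have "coord (linear_ext \<nu> x) v = (\<Sum>u\<in>supp x. if u = \<nu> v then coord x u else 0)"
    unfolding linear_ext_def lookup_sum by (intro sum.cong) auto
  then show ?thesis by (simp add: in_keys_iff)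
qed

lemma supp_linear_ext_invol:
  assumes "\<And>v. \<nu> (\<nu> v) = v"
  shows "supp (linear_ext \<nu> x) = \<nu> ` supp x"
proof -
  have "v \<in> supp (linear_ext \<nu> x) \<longleftrightarrow> \<nu> v \<in> supp x" for v
    by (simp add: in_keys_iff coord_linear_ext_invol[OF assms])
  then show ?thesis using assms by (auto simp: image_iff set_eq_iff) (metis assms)+
qed

text \<open>Acyclic here means contractible. Equivariance is stated as an inclusion; for involutions
  preserving \<open>K\<close>, the inclusions at \<open>\<sigma>\<close> and at its image combine to
  an equality.\<close>

definition acyclic_carrier ::
    "'v set set \<Rightarrow> ('v \<Rightarrow> 'v) \<Rightarrow> 'w set set \<Rightarrow> ('w \<Rightarrow> 'w) \<Rightarrow> ('v set \<Rightarrow> 'w set set) \<Rightarrow> bool"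
    where
  "acyclic_carrier K \<nu> M \<mu> \<Phi> \<longleftrightarrow>
     (\<forall>\<sigma>\<in>K. finite_complex (\<Phi> \<sigma>) \<and> \<Phi> \<sigma> \<subseteq> M \<and> \<Phi> \<sigma> \<noteq> {} \<and> contractible (realization (\<Phi> \<sigma>)) \<and>
       (\<forall>\<rho>\<in>\<Phi> \<sigma>. \<mu> ` \<rho> \<in> \<Phi> (\<nu> ` \<sigma>)) \<and> (\<forall>\<rho>\<in>K. \<rho> \<subseteq> \<sigma> \<longrightarrow> \<Phi> \<rho> \<subseteq> \<Phi> \<sigma>))"

definition carried ::
    "'v set set \<Rightarrow> ('v set \<Rightarrow> 'w set set) \<Rightarrow> (('v \<Rightarrow>\<^sub>0 real) \<Rightarrow> ('w \<Rightarrow>\<^sub>0 real)) \<Rightarrow> bool" where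
  "carried K \<Phi> f \<longleftrightarrow> (\<forall>x\<in>realization K. f x \<in> realization (\<Phi> (supp x)))"

lemma finite_complexD:
  assumes "finite_complex K" and "\<sigma> \<in> K"
  shows "finite \<sigma>" and "\<sigma> \<noteq> {}" and "\<rho> \<subseteq> \<sigma> \<Longrightarrow> \<rho> \<noteq> {} \<Longrightarrow> \<rho> \<in> K"
  using assms unfolding finite_complex_def by blast+

lemma realization_nonempty:
  assumes "finite_complex K" and "K \<noteq> {}"
  shows "realization K \<noteq> {}"
proof -
  obtain \<sigma> where "\<sigma> \<in> K" "\<sigma> \<noteq> {}" using assms by (auto simp: finite_complex_def)
  then show ?thesis unfolding realization_def by auto
qed

lemma realization_Un: "realization (K \<union> L) = realization K \<union> realization L"
  by (auto simp: realization_def)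

text \<open>Induction on the number of simplices missing from \<open>K0\<close>. On the boundary of
  a minimal missing simplex the map already takes values in the contractible
  \<open>\<Phi> \<sigma>\<close>, by monotonicity, so \<open>simplex_extension\<close> applies.
  Freeness makes the image of \<open>\<sigma>\<close> a different simplex, on which equivariance
  dictates the values without conflict.\<close>

theorem carrier_extension:
  fixes K :: "'v set set" and f0 :: "('v \<Rightarrow>\<^sub>0 real) \<Rightarrow> ('w \<Rightarrow>\<^sub>0 real)"
  assumes K: "finite_complex K" and free: "free_involution K \<nu>"
    and \<mu>: "\<And>w. \<mu> (\<mu> w) = w" and \<Phi>: "acyclic_carrier K \<nu> M \<mu> \<Phi>"
    and "K0 \<subseteq> K" and "finite_complex K0" and "\<And>\<sigma>. \<sigma> \<in> K0 \<Longrightarrow> \<nu> ` \<sigma> \<in> K0"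
    and "continuous_on (realization K0) f0"
    and "\<And>x. x \<in> realization K0 \<Longrightarrow> f0 (linear_ext \<nu> x) = linear_ext \<mu> (f0 x)"
    and "carried K0 \<Phi> f0"
  shows "\<exists>f. continuous_on (realization K) f \<and>
    (\<forall>x\<in>realization K. f (linear_ext \<nu> x) = linear_ext \<mu> (f x)) \<and>
    carried K \<Phi> f \<and> (\<forall>x\<in>realization K0. f x = f0 x)"
  using assms(5-)
proof (induction "card (K - K0)" arbitrary: K0 f0 rule: less_induct)
  case less
  note K0 = less.prems(1-3) and f0 = less.prems(4-6)
  have \<nu>: "\<nu> (\<nu> v) = v" for v using free by (simp add: free_involution_def)
  have \<nu>im: "\<nu> ` \<nu> ` A = A" for A by (force simp: \<nu>)
  show ?case
  proof (cases "K0 = K")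
    case True
    then show ?thesis using f0 by (intro exI[of _ f0]) auto
  next
    case False
    then obtain s where s: "s \<in> K - K0" using K0(1) by blast
    \<comment> \<open>Least cardinality puts all proper nonempty faces of \<open>\<sigma>\<close>
      into \<open>K0\<close>, and hence also those of its partner \<open>\<tau>\<close>.\<close>
    obtain \<sigma> where \<sigma>: "\<sigma> \<in> K" "\<sigma> \<notin> K0"
      and least: "\<And>\<rho>. \<rho> \<in> K - K0 \<Longrightarrow> card \<sigma> \<le> card \<rho>"
      using ex_has_least_nat[of "\<lambda>\<rho>. \<rho> \<in> K - K0" s card] s by blast
    note fin = finite_complexD(1)[OF K \<sigma>(1)]
    define \<tau> where "\<tau> = \<nu> ` \<sigma>"
    have \<tau>: "\<tau> \<in> K" "\<tau> \<noteq> \<sigma>" using free \<sigma>(1) by (auto simp: free_involution_def \<tau>_def)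
    have \<nu>\<tau>: "\<nu> ` \<tau> = \<sigma>" by (simp add: \<tau>_def \<nu>im)
    have \<tau>0: "\<tau> \<notin> K0" using K0(3)[of \<tau>] \<sigma>(2) \<nu>\<tau> by auto
    have cards: "card \<tau> = card \<sigma>"
      unfolding \<tau>_def by (intro card_image inj_on_inverseI[where g = \<nu>] \<nu>)
    have fin\<tau>: "finite \<tau>" using fin by (simp add: \<tau>_def)
    have faces: "\<rho> \<in> K0" if "\<rho> \<subseteq> \<sigma>" "\<rho> \<noteq> \<sigma>" "\<rho> \<noteq> {}" for \<rho>
    proof (rule ccontr)
      assume "\<rho> \<notin> K0"
      moreover have "\<rho> \<in> K" using finite_complexD(3)[OF K \<sigma>(1)] that by blast
      ultimately have "card \<sigma> \<le> card \<rho>" using least by blast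
      then show False using card_subset_eq[OF fin that(1)] card_mono[OF fin that(1)] that(2) by simp
    qed
    have faces\<tau>: "\<rho> \<in> K0" if "\<rho> \<subseteq> \<tau>" "\<rho> \<noteq> \<tau>" "\<rho> \<noteq> {}" for \<rho>
    proof -
      have "\<nu> ` \<rho> \<subseteq> \<sigma>" using that(1) \<nu>\<tau> by blast
      moreover have "\<nu> ` \<rho> \<noteq> \<sigma>" using that(2) \<nu>im[of \<rho>] unfolding \<tau>_def by auto
      ultimately have "\<nu> ` \<rho> \<in> K0" using that(3) faces by simp
      from K0(3)[OF this] show ?thesis by (simp add: \<nu>im)
    qed
    define K1 where "K1 = K0 \<union> {\<sigma>, \<tau>}"
    have finK: "finite K" using K by (simp add: finite_complex_def)
    have K1: "K1 \<subseteq> K" "finite_complex K1" "\<And>\<rho>. \<rho> \<in> K1 \<Longrightarrow> \<nu> ` \<rho> \<in> K1"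
    proof -
      show "K1 \<subseteq> K" using K0(1) \<sigma>(1) \<tau>(1) by (simp add: K1_def)
      show "\<nu> ` \<rho> \<in> K1" if "\<rho> \<in> K1" for \<rho>
        using that K0(3) \<nu>\<tau> by (auto simp: K1_def \<tau>_def)
      show "finite_complex K1"
        unfolding finite_complex_def[of K1]
      proof (intro conjI ballI allI impI)
        show "finite K1" using \<open>K1 \<subseteq> K\<close> finK by (rule finite_subset)
        fix \<rho> assume \<rho>: "\<rho> \<in> K1"
        then have "\<rho> \<in> K" using \<open>K1 \<subseteq> K\<close> by blast
        then show "finite \<rho>" "\<rho> \<noteq> {}" using K by (auto simp: finite_complex_def)
        fix \<pi> assume "\<pi> \<subseteq> \<rho>" "\<pi> \<noteq> {}"
        then show "\<pi> \<in> K1"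
          using \<rho> faces[of \<pi>] faces\<tau>[of \<pi>] finite_complexD(3)[OF K0(2), of \<rho> \<pi>]
          unfolding K1_def by auto
      qed
    qed
    let ?S = "convex hull (basis_vec ` \<sigma>) :: ('v \<Rightarrow>\<^sub>0 real) set"
    let ?T = "convex hull (basis_vec ` \<tau>) :: ('v \<Rightarrow>\<^sub>0 real) set"
    have rK1: "realization K1 = realization K0 \<union> (?S \<union> ?T)"
      by (auto simp: K1_def realization_def)
    have bdS: "x \<in> realization K0" if "x \<in> ?S" "supp x \<noteq> \<sigma>" for x
    proof -
      have "x \<in> realization K1" using that(1) by (simp add: rK1)
      then have x: "supp x \<in> K1" "\<forall>u. 0 \<le> coord x u" "(\<Sum>u\<in>supp x. coord x u) = 1"
        by (simp_all add: realization_iff[OF K1(2)])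
      have "supp x \<subseteq> \<sigma>" using that(1) by (simp add: convex_hull_basis[OF fin])
      from faces[OF this that(2) finite_complexD(2)[OF K1(2) x(1)]] show ?thesis
        using x by (simp add: realization_iff[OF K0(2)])
    qed
    note \<Phi>D = \<Phi>[unfolded acyclic_carrier_def, rule_format, OF \<sigma>(1)]
    obtain F where F: "continuous_on ?S F" "\<And>x. x \<in> ?S \<Longrightarrow> F x \<in> realization (\<Phi> \<sigma>)"
        "\<And>x. x \<in> ?S \<Longrightarrow> supp x \<noteq> \<sigma> \<Longrightarrow> F x = f0 x"
    proof (rule simplex_extension[OF fin, where S = "realization (\<Phi> \<sigma>)" and ?f0.0 = f0])
      show "\<sigma> \<noteq> {}" by (rule finite_complexD(2)[OF K \<sigma>(1)])
      show "contractible (realization (\<Phi> \<sigma>))" using \<Phi>D by blast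
      show "realization (\<Phi> \<sigma>) \<noteq> {}" using \<Phi>D by (intro realization_nonempty) blast+
      show "continuous_on {x \<in> ?S. supp x \<noteq> \<sigma>} f0"
        by (rule continuous_on_subset[OF f0(1)]) (use bdS in blast)
      show "f0 x \<in> realization (\<Phi> \<sigma>)" if "x \<in> ?S" "supp x \<noteq> \<sigma>" for x
      proof -
        have x: "x \<in> realization K0" by (rule bdS[OF that])
        then have "supp x \<in> K" using K0(1) by (auto simp: realization_iff[OF K0(2)])
        moreover have "supp x \<subseteq> \<sigma>" using that by (simp add: convex_hull_basis[OF fin])
        ultimately have "\<Phi> (supp x) \<subseteq> \<Phi> \<sigma>" using \<Phi>D by blast
        with x f0(3) show ?thesis using realization_mono unfolding carried_def by blast
      qed
    qed (use that in blast)
    \<comment> \<open>Splitting by the exact support makes the three cases disjoint, with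
      \<open>f0\<close> left in charge of the boundaries of \<open>\<sigma>\<close> and
      \<open>\<tau>\<close>.\<close>
    define f where "f x = (if supp x = \<sigma> then F x
      else if supp x = \<tau> then linear_ext \<mu> (F (linear_ext \<nu> x)) else f0 x)" for x
    have \<nu>S: "linear_ext \<nu> x \<in> ?S" if "x \<in> ?T" for x
      using linear_ext_realization[of "{\<tau>}" \<nu> "{\<sigma>}" x] \<nu>\<tau> that by (simp add: realization_def)
    have \<nu>T: "linear_ext \<nu> x \<in> ?T" if "x \<in> ?S" for x
      using linear_ext_realization[of "{\<sigma>}" \<nu> "{\<tau>}" x] that by (simp add: realization_def \<tau>_def)
    have supp\<nu>: "supp (linear_ext \<nu> x) = \<nu> ` supp x" for x
      by (rule supp_linear_ext_invol) (rule \<nu>)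
    have \<nu>\<nu>: "linear_ext \<nu> (linear_ext \<nu> x) = x" for x
      by (rule linear_ext_invol) (rule \<nu>)
    have \<mu>\<mu>: "linear_ext \<mu> (linear_ext \<mu> x) = x" for x
      by (rule linear_ext_invol) (rule \<mu>)
    have f_0: "f x = f0 x" if "x \<in> realization K0" for x
      using that \<sigma>(2) \<tau>0 by (auto simp: f_def realization_iff[OF K0(2)])
    \<comment> \<open>The formulas on the open simplices persist on the closed ones, since they
      agree with \<open>f0\<close> on the boundary. Continuity of \<open>f\<close> then follows by
      gluing along closed sets.\<close>
    have f_S: "f x = F x" if x: "x \<in> ?S" for x
    proof (cases "supp x = \<sigma>")
      case False
      have "supp x \<noteq> \<tau>" using \<tau>(2) x card_subset_eq[OF fin _ cards]
        by (auto simp: convex_hull_basis[OF fin])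
      then show ?thesis using False F(3)[OF x] by (simp add: f_def)
    qed (simp add: f_def)
    have f_T: "f x = linear_ext \<mu> (F (linear_ext \<nu> x))" if x: "x \<in> ?T" for x
    proof (cases "supp x = \<tau>")
      case True
      then show ?thesis using \<tau>(2) by (simp add: f_def)
    next
      case False
      have n: "supp (linear_ext \<nu> x) \<noteq> \<sigma>" using False \<nu>im[of "supp x"] by (auto simp: supp\<nu> \<tau>_def)
      have b: "linear_ext \<nu> x \<in> realization K0" by (rule bdS[OF \<nu>S[OF x] n])
      have "supp x \<noteq> \<sigma>" using \<tau>(2) x card_subset_eq[OF fin\<tau> _ cards[symmetric]]
        by (auto simp: convex_hull_basis[OF fin\<tau>])
      then show ?thesis
        using False f0(2)[OF b] F(3)[OF \<nu>S[OF x] n] by (simp add: f_def \<nu>\<nu> \<mu>\<mu>)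
    qed
    have clS: "closed ?S" and clT: "closed ?T"
      using fin fin\<tau> by (auto intro!: compact_imp_closed finite_imp_compact_convex_hull)
    have "continuous_on ?T (\<lambda>x. linear_ext \<mu> (F (linear_ext \<nu> x)))"
    proof -
      have "continuous_on ?T (\<lambda>x. F (linear_ext \<nu> x))"
        by (rule continuous_on_compose2[OF F(1) continuous_on_linear_ext]) (use \<nu>S in blast)
      then show ?thesis
        by (rule continuous_on_compose2[OF continuous_on_linear_ext]) auto
    qed
    then have cT: "continuous_on ?T f" using f_T by (simp cong: continuous_on_cong)
    have cS: "continuous_on ?S f" using f_S F(1) by (simp cong: continuous_on_cong)
    have c0: "continuous_on (realization K0) f" using f_0 f0(1) by (simp cong: continuous_on_cong)
    have cont: "continuous_on (realization K1) f"
      unfolding rK1 by (intro continuous_on_closed_Un closed_Un clS clT closed_realization K0 c0 cS cT)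
    have equi: "f (linear_ext \<nu> x) = linear_ext \<mu> (f x)" if x: "x \<in> realization K1" for x
    proof -
      consider "x \<in> realization K0" | "x \<in> ?S" | "x \<in> ?T" using x rK1 by blast
      then show ?thesis
      proof cases
        case 1
        have "\<nu> ` supp x \<in> K0" using 1 K0(3) by (simp add: realization_iff[OF K0(2)])
        then have "linear_ext \<nu> x \<in> realization K0"
          by (rule linear_ext_in_realization[OF K0(2) 1])
        then show ?thesis using f0(2) 1 f_0 by simp
      next
        case 2
        then show ?thesis using f_S[OF 2] f_T[OF \<nu>T[OF 2]] by (simp add: \<nu>\<nu>)
      next
        case 3
        then show ?thesis using f_T[OF 3] f_S[OF \<nu>S[OF 3]] by (simp add: \<mu>\<mu>)
      qed
    qed
    have car: "carried K1 \<Phi> f"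
      unfolding carried_def
    proof
      fix x assume x: "x \<in> realization K1"
      have "supp x \<in> K1" using x by (simp add: realization_iff[OF K1(2)])
      then consider "supp x = \<sigma>" | "supp x = \<tau>" | "supp x \<in> K0"
        by (auto simp: K1_def)
      then show "f x \<in> realization (\<Phi> (supp x))"
      proof cases
        case 1
        then have "x \<in> ?S" using in_hull_supp[OF K1(2) x] by (simp add: realization_def)
        then show ?thesis using F(2) f_S 1 by simp
      next
        case 2
        then have xT: "x \<in> ?T" using in_hull_supp[OF K1(2) x] by (simp add: realization_def)
        have "linear_ext \<mu> (F (linear_ext \<nu> x)) \<in> realization (\<Phi> \<tau>)"
          by (rule linear_ext_realization[OF _ F(2)[OF \<nu>S[OF xT]]]) (use \<Phi>D \<tau>_def in blast)
        then show ?thesis using 2 f_T[OF xT] by simp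
      next
        case 3
        then have "x \<in> realization K0"
          using x by (simp add: realization_iff[OF K1(2)] realization_iff[OF K0(2)])
        then show ?thesis using f0(3) f_0 by (simp add: carried_def)
      qed
    qed
    have "card (K - K1) < card (K - K0)"
      by (rule psubset_card_mono) (use finK \<sigma> K1_def in auto)
    from less.hyps[OF this K1 cont equi car] obtain f' where f':
      "continuous_on (realization K) f'" "\<forall>x\<in>realization K. f' (linear_ext \<nu> x) = linear_ext \<mu> (f' x)"
      "carried K \<Phi> f'" "\<forall>x\<in>realization K1. f' x = f x" by blast
    then show ?thesis using f_0 rK1 by (intro exI[of _ f']) auto
  qed
qed

lemma Z2_map_realization_space:
  "Z2_map (realization_space K \<nu>) (realization_space M \<mu>) f \<longleftrightarrow>
     continuous_on (realization K) f \<and> f ` realization K \<subseteq> realization M \<and>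
     (\<forall>x\<in>realization K. f (linear_ext \<nu> x) = linear_ext \<mu> (f x))"
  by (auto simp: Z2_map_def realization_space_def)

lemma linear_ext_free_involution:
  assumes "finite_complex K" and "free_involution K \<nu>" and "x \<in> realization K"
  shows "linear_ext \<nu> x \<in> realization K"
  using assms by (intro linear_ext_in_realization)
    (auto simp: realization_iff free_involution_def)

lemma carried_subset:
  assumes "finite_complex K" and "acyclic_carrier K \<nu> M \<mu> \<Phi>" and "carried K \<Phi> f"
  shows "f ` realization K \<subseteq> realization M"
proof
  fix y assume "y \<in> f ` realization K"
  then obtain x where x: "x \<in> realization K" "y = f x" by blast
  then have "supp x \<in> K" using realization_iff[OF assms(1)] by blast
  then have "\<Phi> (supp x) \<subseteq> M" using assms(2) by (simp add: acyclic_carrier_def)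
  then show "y \<in> realization M"
    using x assms(3) realization_mono unfolding carried_def by blast
qed

text \<open>Extension from the empty subcomplex, over which any function, here
  \<open>undefined\<close>, is a valid starting map.\<close>

lemma carried_map_exists:
  assumes "finite_complex K" and "free_involution K \<nu>"
    and "\<And>w. \<mu> (\<mu> w) = w" and "acyclic_carrier K \<nu> M \<mu> \<Phi>"
  obtains f where "Z2_map (realization_space K \<nu>) (realization_space M \<mu>) f" and "carried K \<Phi> f"
proof -
  have "\<exists>f. continuous_on (realization K) f \<and>
    (\<forall>x\<in>realization K. f (linear_ext \<nu> x) = linear_ext \<mu> (f x)) \<and>
    carried K \<Phi> f \<and> (\<forall>x\<in>realization {}. f x = undefined x)"
    by (rule carrier_extension[OF assms(1,2), where M = M])
      (use assms(3,4) in \<open>auto simp: finite_complex_def realization_def carried_def\<close>)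
  then show ?thesis
    using that carried_subset[OF assms(1,4)] by (auto simp: Z2_map_realization_space)
qed

lemma supp_linear_ext_subset: "supp (linear_ext \<phi> x) \<subseteq> \<phi> ` supp x"
proof
  fix w assume "w \<in> supp (linear_ext \<phi> x)"
  then have "(\<Sum>u\<in>supp x. coord x u * (if w = \<phi> u then 1 else 0)) \<noteq> 0"
    by (simp add: in_keys_iff linear_ext_def lookup_sum)
  then obtain u where "u \<in> supp x" "coord x u * (if w = \<phi> u then 1 else 0) \<noteq> 0"
    by (meson sum.neutral)
  then show "w \<in> \<phi> ` supp x" by (auto split: if_splits)
qed

lemma realization_singleton [simp]: "realization {{v}} = {basis_vec v}"
  by (simp add: realization_def)

section \<open>Uniqueness of carried maps up to equivariant homotopy\<close>

definition thick_complex :: "'v set set \<Rightarrow> ('v \<times> bool) set set" where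
  "thick_complex K = {\<rho>. fst ` \<rho> \<in> K}"

lemma finite_thick_complex:
  assumes "finite_complex K"
  shows "finite_complex (thick_complex K)"
  unfolding finite_complex_def
proof (intro conjI ballI allI impI)
  have sub: "thick_complex K \<subseteq> Pow (\<Union>K \<times> UNIV)"
  proof
    fix \<rho> assume "\<rho> \<in> thick_complex K"
    then have "fst ` \<rho> \<subseteq> \<Union>K" by (auto simp: thick_complex_def)
    then show "\<rho> \<in> Pow (\<Union>K \<times> UNIV)" by (fastforce simp: image_subset_iff)
  qed
  have fin: "finite (\<Union>K \<times> (UNIV :: bool set))"
    using assms by (auto simp: finite_complex_def)
  show "finite (thick_complex K)"
    by (rule finite_subset[OF sub]) (use fin in simp)
  fix \<rho> assume \<rho>: "\<rho> \<in> thick_complex K"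
  show "finite \<rho>" using \<rho> sub fin by (meson PowD finite_subset subsetD)
  show "\<rho> \<noteq> {}" using \<rho> assms by (auto simp: thick_complex_def finite_complex_def)
  fix \<pi> assume "\<pi> \<subseteq> \<rho>" "\<pi> \<noteq> {}"
  then show "\<pi> \<in> thick_complex K"
    using \<rho> finite_complexD(3)[OF assms, of "fst ` \<rho>" "fst ` \<pi>"]
    by (auto simp: thick_complex_def)
qed

text \<open>The prism over \<open>|K|\<close> embeds into the complex whose simplices are all sets of vertices
  \<open>(v, b)\<close> projecting to a simplex of \<open>K\<close>, so a homotopy is an extension from its two ends.\<close>

theorem carried_homotopic:
  fixes K :: "'v set set" and M :: "'w set set"
  assumes K: "finite_complex K" and free: "free_involution K \<nu>"
    and \<mu>: "\<And>w. \<mu> (\<mu> w) = w" and \<Phi>: "acyclic_carrier K \<nu> M \<mu> \<Phi>"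
    and f: "Z2_map (realization_space K \<nu>) (realization_space M \<mu>) f" "carried K \<Phi> f"
    and g: "Z2_map (realization_space K \<nu>) (realization_space M \<mu>) g" "carried K \<Phi> g"
  shows "Z2_homotopic (realization_space K \<nu>) (realization_space M \<mu>) f g"
proof -
  let ?D = "\<lambda>b (v::'v). (v, b)"
  define T where "T = thick_complex K"
  define \<Psi> where "\<Psi> \<rho> = \<Phi> (fst ` \<rho>)" for \<rho> :: "('v \<times> bool) set"
  define \<eta> where "\<eta> = map_prod \<nu> (id :: bool \<Rightarrow> bool)"
  define E where "E b = {\<rho> \<in> T. snd ` \<rho> = {b}}" for b
  \<comment> \<open>\<open>E False\<close> and \<open>E True\<close> are the two ends. Pushing a
    point of \<open>E b\<close> forward along \<open>snd\<close> gives the basis vector at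
    \<open>b\<close>, so the coordinate at \<open>True\<close> tells the ends apart;
    \<open>fst\<close> recovers the point of \<open>K\<close>.\<close>
  define f0 where "f0 z = (if coord (linear_ext snd z) True = 0
    then f (linear_ext fst z) else g (linear_ext fst z))" for z
  have \<nu>: "\<nu> (\<nu> v) = v" for v using free by (simp add: free_involution_def)
  have T: "finite_complex T" unfolding T_def by (rule finite_thick_complex[OF K])
  have fst\<eta>: "fst ` \<eta> ` \<rho> = \<nu> ` fst ` \<rho>" and snd\<eta>: "snd ` \<eta> ` \<rho> = snd ` \<rho>" for \<rho>
    by (force simp: \<eta>_def)+
  have freeT: "free_involution T \<eta>"
    unfolding free_involution_def
  proof (intro conjI allI ballI)
    show "\<eta> (\<eta> p) = p" for p by (cases p) (simp add: \<eta>_def \<nu>)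
    fix \<rho> assume "\<rho> \<in> T"
    then have "fst ` \<rho> \<in> K" by (simp add: T_def thick_complex_def)
    then have "\<nu> ` fst ` \<rho> \<in> K" "\<nu> ` fst ` \<rho> \<noteq> fst ` \<rho>"
      using free by (auto simp: free_involution_def)
    then show "\<eta> ` \<rho> \<in> T" "\<eta> ` \<rho> \<noteq> \<rho>"
      using fst\<eta>[of \<rho>] by (simp add: T_def thick_complex_def, metis)
  qed
  have \<Psi>: "acyclic_carrier T \<eta> M \<mu> \<Psi>"
    unfolding acyclic_carrier_def
  proof
    fix \<rho> assume "\<rho> \<in> T"
    then have "fst ` \<rho> \<in> K" by (simp add: T_def thick_complex_def)
    from bspec[OF \<Phi>[unfolded acyclic_carrier_def] this]
    show "finite_complex (\<Psi> \<rho>) \<and> \<Psi> \<rho> \<subseteq> M \<and> \<Psi> \<rho> \<noteq> {} \<and>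
        contractible (realization (\<Psi> \<rho>)) \<and> (\<forall>\<pi>\<in>\<Psi> \<rho>. \<mu> ` \<pi> \<in> \<Psi> (\<eta> ` \<rho>)) \<and>
        (\<forall>\<pi>\<in>T. \<pi> \<subseteq> \<rho> \<longrightarrow> \<Psi> \<pi> \<subseteq> \<Psi> \<rho>)"
      unfolding \<Psi>_def fst\<eta> T_def thick_complex_def by (simp add: image_mono)
  qed
  have E: "finite_complex (E b)" for b
    unfolding finite_complex_def
  proof (intro conjI ballI allI impI)
    show "finite (E b)" using T by (simp add: E_def finite_complex_def)
    fix \<rho> assume \<rho>: "\<rho> \<in> E b"
    then show "finite \<rho>" "\<rho> \<noteq> {}" using T by (auto simp: E_def finite_complex_def)
    fix \<pi> assume "\<pi> \<subseteq> \<rho>" "\<pi> \<noteq> {}"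
    then show "\<pi> \<in> E b" using \<rho> finite_complexD(3)[OF T, of \<rho> \<pi>] by (auto simp: E_def)
  qed
  have fstE: "linear_ext fst z \<in> realization K" if "z \<in> realization (E b)" for z b
    by (rule linear_ext_in_realization[OF E that])
      (use that realization_iff[OF E] in \<open>auto simp: E_def T_def thick_complex_def\<close>)
  have sndE: "linear_ext snd z = basis_vec b" if "z \<in> realization (E b)" for z b
    using linear_ext_in_realization[OF E that, of snd "{{b}}"] that realization_iff[OF E]
    by (auto simp: E_def)
  have f0F: "f0 z = f (linear_ext fst z)" if "z \<in> realization (E False)" for z
    using sndE[OF that] by (simp add: f0_def)
  have f0T: "f0 z = g (linear_ext fst z)" if "z \<in> realization (E True)" for z
    using sndE[OF that] by (simp add: f0_def)
  note f' = f(1)[unfolded Z2_map_realization_space] and g' = g(1)[unfolded Z2_map_realization_space]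
  have inE: "z \<in> realization (E False) \<or> z \<in> realization (E True)"
    if "z \<in> realization (E False \<union> E True)" for z
    using that by (simp add: realization_Un)
  have "\<exists>F. continuous_on (realization T) F \<and>
    (\<forall>x\<in>realization T. F (linear_ext \<eta> x) = linear_ext \<mu> (F x)) \<and>
    carried T \<Psi> F \<and> (\<forall>x\<in>realization (E False \<union> E True). F x = f0 x)"
  proof (rule carrier_extension[OF T freeT \<mu> \<Psi>])
    show "E False \<union> E True \<subseteq> T" by (auto simp: E_def)
    show "finite_complex (E False \<union> E True)"
      using E[of False] E[of True] by (auto simp: finite_complex_def)
    show "\<eta> ` \<sigma> \<in> E False \<union> E True" if "\<sigma> \<in> E False \<union> E True" for \<sigma>
      using that freeT by (auto simp: E_def snd\<eta> free_involution_def)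
    have "continuous_on (realization (E False)) (\<lambda>z. f (linear_ext fst z))"
      by (rule continuous_on_compose2[OF _ continuous_on_linear_ext]) (use f' fstE in auto)
    then have "continuous_on (realization (E False)) f0"
      using f0F by (simp cong: continuous_on_cong)
    moreover have "continuous_on (realization (E True)) (\<lambda>z. g (linear_ext fst z))"
      by (rule continuous_on_compose2[OF _ continuous_on_linear_ext]) (use g' fstE in auto)
    then have "continuous_on (realization (E True)) f0"
      using f0T by (simp cong: continuous_on_cong)
    ultimately show "continuous_on (realization (E False \<union> E True)) f0"
      unfolding realization_Un
      by (intro continuous_on_closed_Un closed_realization E)
    show "f0 (linear_ext \<eta> z) = linear_ext \<mu> (f0 z)"
      if "z \<in> realization (E False \<union> E True)" for z
    proof -
      have inv: "linear_ext \<eta> z \<in> realization (E b)" if "z \<in> realization (E b)" for b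
        by (rule linear_ext_in_realization[OF E that])
          (use that realization_iff[OF E] freeT in \<open>auto simp: E_def snd\<eta> free_involution_def\<close>)
      have "fst \<circ> \<eta> = \<nu> \<circ> fst" by (auto simp: \<eta>_def)
      then have eq: "linear_ext fst (linear_ext \<eta> z) = linear_ext \<nu> (linear_ext fst z)"
        by (simp add: linear_ext_comp)
      from inE[OF that] show ?thesis
      proof
        assume z: "z \<in> realization (E False)"
        then show ?thesis using f0F[OF z] f0F[OF inv[OF z]] f' fstE[OF z] by (simp add: eq)
      next
        assume z: "z \<in> realization (E True)"
        then show ?thesis using f0T[OF z] f0T[OF inv[OF z]] g' fstE[OF z] by (simp add: eq)
      qed
    qed
    show "carried (E False \<union> E True) \<Psi> f0"
      unfolding carried_def
    proof
      fix z assume z: "z \<in> realization (E False \<union> E True)"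
      then obtain b where b: "z \<in> realization (E b)" using inE by blast
      have s: "supp (linear_ext fst z) \<in> K" using fstE[OF b] realization_iff[OF K] by blast
      have t: "fst ` supp z \<in> K"
        using b realization_iff[OF E] by (auto simp: E_def T_def thick_complex_def)
      have "\<Phi> (supp (linear_ext fst z)) \<subseteq> \<Psi> (supp z)"
        using \<Phi> s t supp_linear_ext_subset[of fst z] by (simp add: acyclic_carrier_def \<Psi>_def)
      then have "realization (\<Phi> (supp (linear_ext fst z))) \<subseteq> realization (\<Psi> (supp z))"
        by (rule realization_mono)
      then show "f0 z \<in> realization (\<Psi> (supp z))"
        using inE[OF z] f0F f0T f(2) g(2) fstE unfolding carried_def by auto
    qed
  qed
  then obtain F where F: "continuous_on (realization T) F"
    "\<And>z. z \<in> realization T \<Longrightarrow> F (linear_ext \<eta> z) = linear_ext \<mu> (F z)"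
    "carried T \<Psi> F" "\<And>z. z \<in> realization (E False \<union> E True) \<Longrightarrow> F z = f0 z" by blast
  \<comment> \<open>The segment joining the two copies of \<open>x\<close>. It lies in one simplex,
    \<open>supp x \<times> UNIV\<close>, which is why the thick complex contains all sets over a
    simplex and no triangulation of the prism is chosen.\<close>
  define P where "P p = (1 - fst p) *\<^sub>R linear_ext (?D False) (snd p)
      + fst p *\<^sub>R linear_ext (?D True) (snd p)" for p :: "real \<times> ('v \<Rightarrow>\<^sub>0 real)"
  have PT: "P (t, x) \<in> realization T" if t: "t \<in> {0..1}" and x: "x \<in> realization K" for t x
  proof -
    define \<sigma> where "\<sigma> = supp x"
    have \<sigma>: "\<sigma> \<in> K" using x realization_iff[OF K] by (auto simp: \<sigma>_def)
    have *: "linear_ext (?D b) x \<in> realization {\<sigma> \<times> UNIV}" for b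
    proof -
      have "linear_ext (?D b) x \<in> realization {?D b ` \<sigma>}"
        by (rule linear_ext_in_realization[OF K x]) (simp add: \<sigma>_def)
      moreover have "convex hull (basis_vec ` ?D b ` \<sigma>) \<subseteq> convex hull (basis_vec ` (\<sigma> \<times> UNIV))"
        by (intro hull_mono image_mono) auto
      ultimately show ?thesis by (auto simp: realization_def)
    qed
    have "P (t, x) \<in> realization {\<sigma> \<times> UNIV}"
      using t *[of False] *[of True] unfolding P_def realization_def
      by (simp add: convexD_alt)
    moreover have "\<sigma> \<times> UNIV \<in> T" using \<sigma> by (simp add: T_def thick_complex_def)
    ultimately show ?thesis using realization_mono[of "{\<sigma> \<times> UNIV}" T] by blast
  qed
  have ends: "linear_ext (?D b) x \<in> realization (E b)" if "x \<in> realization K" for x b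
  proof (rule linear_ext_in_realization[OF K that])
    have "supp x \<in> K" "supp x \<noteq> {}"
      using that realization_iff[OF K] finite_complexD(2)[OF K] by blast+
    then show "?D b ` supp x \<in> E b"
      by (auto simp: E_def T_def thick_complex_def image_image simp del: keys_eq_empty)
  qed
  have fstD: "linear_ext fst (linear_ext (?D b) x) = x" for b x
    by (simp add: linear_ext_comp comp_def linear_ext_id)
  \<comment> \<open>The pointwise description of \<open>homotopic_with\<close> demands that being a
    \<open>Z2_map\<close> depend only on the values on the space.\<close>
  have cong: "Z2_map (realization_space K \<nu>) (realization_space M \<mu>) h \<longleftrightarrow>
      Z2_map (realization_space K \<nu>) (realization_space M \<mu>) k"
    if "\<And>x. x \<in> topspace (Z2_top (realization_space K \<nu>)) \<Longrightarrow> h x = k x" for h k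
  proof -
    have hk: "h x = k x" if "x \<in> realization K" for x
      using that \<open>\<And>x. x \<in> topspace _ \<Longrightarrow> h x = k x\<close> by (simp add: realization_space_def)
    then show ?thesis
      unfolding Z2_map_realization_space
      using linear_ext_free_involution[OF K free] by (simp cong: continuous_on_cong image_cong)
  qed
  have contP: "continuous_on ({0..1} \<times> realization K) (F \<circ> P)"
  proof (rule continuous_on_compose)
    show "continuous_on ({0..1} \<times> realization K) P"
      unfolding P_def
      by (intro continuous_intros continuous_on_compose2[OF continuous_on_linear_ext[of UNIV]]) auto
    show "continuous_on (P ` ({0..1} \<times> realization K)) F"
      by (rule continuous_on_subset[OF F(1)]) (use PT in auto)
  qed
  have FM: "F (P (t, x)) \<in> realization M" if "t \<in> {0..1}" "x \<in> realization K" for t x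
    using carried_subset[OF T \<Psi> F(3)] PT[OF that] by blast
  have P\<nu>: "P (t, linear_ext \<nu> x) = linear_ext \<eta> (P (t, x))" for t x
  proof -
    have "?D b \<circ> \<nu> = \<eta> \<circ> ?D b" for b by (auto simp: \<eta>_def)
    then show ?thesis
      by (simp add: P_def linear_ext_comp linear_add[OF linear_linear_ext]
          linear_cmul[OF linear_linear_ext])
  qed
  show ?thesis
    unfolding Z2_homotopic_def
  proof (rule iffD2[OF homotopic_with[OF cong]], assumption, intro exI[of _ "F \<circ> P"] conjI ballI)
    show "continuous_map (prod_topology (top_of_set {0..1}) (Z2_top (realization_space K \<nu>)))
       (Z2_top (realization_space M \<mu>)) (F \<circ> P)"
      using contP FM by (auto simp: realization_space_def)
    fix x assume "x \<in> topspace (Z2_top (realization_space K \<nu>))"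
    then have x: "x \<in> realization K" by (simp add: realization_space_def)
    show "(F \<circ> P) (0, x) = f x"
      using F(4) f0F ends[OF x, of False] by (simp add: P_def fstD realization_Un)
    show "(F \<circ> P) (1, x) = g x"
      using F(4) f0T ends[OF x, of True] by (simp add: P_def fstD realization_Un)
  next
    fix t :: real assume t: "t \<in> {0..1}"
    have "continuous_on (realization K) (\<lambda>x. (F \<circ> P) (t, x))"
      by (rule continuous_on_compose2[OF contP]) (use t in \<open>auto intro!: continuous_intros\<close>)
    then show "Z2_map (realization_space K \<nu>) (realization_space M \<mu>) (\<lambda>x. (F \<circ> P) (t, x))"
      unfolding Z2_map_realization_space using FM[OF t] F(2) PT[OF t] by (auto simp: P\<nu>)
  qed
qed

section \<open>Homotopy equivalences from carriers\<close>

lemma Z2_map_comp: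
  assumes "Z2_map X Y f" and "Z2_map Y Z g"
  shows "Z2_map X Z (g \<circ> f)"
  using assms unfolding Z2_map_def
  by (auto intro: continuous_map_compose dest: continuous_map_image_subset_topspace)

lemma Z2_homotopic_compose_left:
  assumes "Z2_homotopic X Y f g" and "Z2_map Y Z h"
  shows "Z2_homotopic X Z (h \<circ> f) (h \<circ> g)"
  using assms unfolding Z2_homotopic_def
  by (intro homotopic_with_compose_continuous_map_left[where p = "Z2_map X Y"])
    (auto simp: Z2_map_comp Z2_map_def[of Y Z])

lemma Z2_homotopic_compose_right:
  assumes "Z2_homotopic Y Z f g" and "Z2_map X Y h"
  shows "Z2_homotopic X Z (f \<circ> h) (g \<circ> h)"
  unfolding Z2_homotopic_def
  by (rule homotopic_with_compose_continuous_map_right[OF assms(1)[unfolded Z2_homotopic_def]])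
    (use assms(2) in \<open>simp add: Z2_map_def\<close>, rule Z2_map_comp[OF assms(2)])

lemma Z2_homotopic_trans:
  "Z2_homotopic X Y f g \<Longrightarrow> Z2_homotopic X Y g h \<Longrightarrow> Z2_homotopic X Y f h"
  unfolding Z2_homotopic_def by (rule homotopic_with_trans)

lemma Z2_homotopy_equivalence_comp:
  assumes "Z2_homotopy_equivalence X Y f" and "Z2_homotopy_equivalence Y Z g"
  shows "Z2_homotopy_equivalence X Z (g \<circ> f)"
proof -
  obtain f' where f: "Z2_map X Y f" "Z2_map Y X f'"
    "Z2_homotopic X X (f' \<circ> f) id" "Z2_homotopic Y Y (f \<circ> f') id"
    using assms(1) by (auto simp: Z2_homotopy_equivalence_def)
  obtain g' where g: "Z2_map Y Z g" "Z2_map Z Y g'"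
    "Z2_homotopic Y Y (g' \<circ> g) id" "Z2_homotopic Z Z (g \<circ> g') id"
    using assms(2) by (auto simp: Z2_homotopy_equivalence_def)
  have "Z2_homotopic X X (f' \<circ> ((g' \<circ> g) \<circ> f)) (f' \<circ> (id \<circ> f))"
    by (intro Z2_homotopic_compose_left[OF Z2_homotopic_compose_right[OF g(3) f(1)] f(2)])
  then have "Z2_homotopic X X ((f' \<circ> g') \<circ> (g \<circ> f)) id"
    using Z2_homotopic_trans[OF _ f(3)] by (simp add: comp_assoc)
  moreover have "Z2_homotopic Z Z (g \<circ> ((f \<circ> f') \<circ> g')) (g \<circ> (id \<circ> g'))"
    by (intro Z2_homotopic_compose_left[OF Z2_homotopic_compose_right[OF f(4) g(2)] g(1)])
  then have "Z2_homotopic Z Z ((g \<circ> f) \<circ> (f' \<circ> g')) id"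
    using Z2_homotopic_trans[OF _ g(4)] by (simp add: comp_assoc)
  ultimately show ?thesis
    using Z2_map_comp[OF f(1) g(1)] Z2_map_comp[OF g(2) f(2)]
    unfolding Z2_homotopy_equivalence_def by blast
qed

text \<open>A homotopy inverse of \<open>e\<close> is also one of \<open>f\<close>. This passes the
  property from a composite of equivalences to the projection.\<close>

lemma Z2_homotopy_equivalence_homotopic:
  assumes "Z2_homotopy_equivalence X Y e" and "Z2_homotopic X Y f e"
  shows "Z2_homotopy_equivalence X Y f"
proof -
  obtain e' where e: "Z2_map Y X e'"
    "Z2_homotopic X X (e' \<circ> e) id" "Z2_homotopic Y Y (e \<circ> e') id"
    using assms(1) by (auto simp: Z2_homotopy_equivalence_def)
  have "Z2_map X Y f"
    using homotopic_with_imp_property assms(2) unfolding Z2_homotopic_def by blast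
  moreover have "Z2_homotopic X X (e' \<circ> f) id"
    by (rule Z2_homotopic_trans[OF Z2_homotopic_compose_left[OF assms(2) e(1)] e(2)])
  moreover have "Z2_homotopic Y Y (f \<circ> e') id"
    by (rule Z2_homotopic_trans[OF Z2_homotopic_compose_right[OF assms(2) e(1)] e(3)])
  ultimately show ?thesis using e(1) unfolding Z2_homotopy_equivalence_def by blast
qed

lemma Z2_homotopy_equivalence_imp_equivalent_sym:
  assumes "Z2_homotopy_equivalence X Y f"
  shows "Z2_homotopy_equivalent Y X"
  using assms unfolding Z2_homotopy_equivalent_def Z2_homotopy_equivalence_def by blast

lemma Z2_map_id: "Z2_map X X id"
  by (simp add: Z2_map_def)

text \<open>The support of \<open>f x\<close> is a simplex of \<open>\<Phi> (supp x)\<close>, so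
  comparing \<open>\<Psi>\<close> on such simplices with \<open>\<alpha>\<close> is enough.\<close>

lemma carried_comp:
  assumes "finite_complex K" and "acyclic_carrier K \<nu> M \<mu> \<Phi>" and "carried K \<Phi> f"
    and "carried M \<Psi> g" and "\<And>\<sigma> \<rho>. \<sigma> \<in> K \<Longrightarrow> \<rho> \<in> \<Phi> \<sigma> \<Longrightarrow> \<Psi> \<rho> \<subseteq> \<alpha> \<sigma>"
  shows "carried K \<alpha> (g \<circ> f)"
  unfolding carried_def
proof
  fix x assume x: "x \<in> realization K"
  then have s: "supp x \<in> K" by (simp add: realization_iff[OF assms(1)])
  then have \<Phi>: "finite_complex (\<Phi> (supp x))" using assms(2) by (simp add: acyclic_carrier_def)
  have fx: "f x \<in> realization (\<Phi> (supp x))" using x assms(3) by (simp add: carried_def)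
  then have "supp (f x) \<in> \<Phi> (supp x)" by (simp add: realization_iff[OF \<Phi>])
  then have "\<Psi> (supp (f x)) \<subseteq> \<alpha> (supp x)" using s assms(5) by blast
  then have "realization (\<Psi> (supp (f x))) \<subseteq> realization (\<alpha> (supp x))" by (rule realization_mono)
  moreover have "f x \<in> realization M" using carried_subset[OF assms(1-3)] x by blast
  ultimately show "(g \<circ> f) x \<in> realization (\<alpha> (supp x))"
    using assms(4) by (auto simp: carried_def)
qed

lemma carried_id:
  assumes "finite_complex K" and "\<And>\<sigma>. \<sigma> \<in> K \<Longrightarrow> \<sigma> \<in> \<alpha> \<sigma>"
  shows "carried K \<alpha> id"
  unfolding carried_def
proof
  fix x assume x: "x \<in> realization K"
  then have "{supp x} \<subseteq> \<alpha> (supp x)" using assms by (simp add: realization_iff)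
  then show "id x \<in> realization (\<alpha> (supp x))"
    using realization_mono[of "{supp x}"] in_hull_supp[OF assms(1) x] by auto
qed

text \<open>Some \<open>g\<close> is carried by \<open>\<Psi>\<close>. The composite
  \<open>g \<circ> f\<close> and the identity are both carried by \<open>\<alpha>\<close>, and
  likewise \<open>f \<circ> g\<close> by \<open>\<beta>\<close>, so uniqueness of carried maps
  supplies both homotopies.\<close>

theorem carried_equivalence:
  assumes K: "finite_complex K" "free_involution K \<nu>" and M: "finite_complex M" "free_involution M \<mu>"
    and \<Phi>: "acyclic_carrier K \<nu> M \<mu> \<Phi>" and \<Psi>: "acyclic_carrier M \<mu> K \<nu> \<Psi>"
    and \<alpha>: "acyclic_carrier K \<nu> K \<nu> \<alpha>" and \<beta>: "acyclic_carrier M \<mu> M \<mu> \<beta>"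
    and "\<And>\<sigma>. \<sigma> \<in> K \<Longrightarrow> \<sigma> \<in> \<alpha> \<sigma>" and "\<And>\<rho>. \<rho> \<in> M \<Longrightarrow> \<rho> \<in> \<beta> \<rho>"
    and "\<And>\<sigma> \<rho>. \<sigma> \<in> K \<Longrightarrow> \<rho> \<in> \<Phi> \<sigma> \<Longrightarrow> \<Psi> \<rho> \<subseteq> \<alpha> \<sigma>"
    and "\<And>\<rho> \<sigma>. \<rho> \<in> M \<Longrightarrow> \<sigma> \<in> \<Psi> \<rho> \<Longrightarrow> \<Phi> \<sigma> \<subseteq> \<beta> \<rho>"
    and f: "Z2_map (realization_space K \<nu>) (realization_space M \<mu>) f" "carried K \<Phi> f"
  shows "Z2_homotopy_equivalence (realization_space K \<nu>) (realization_space M \<mu>) f"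
proof -
  have \<nu>: "\<nu> (\<nu> v) = v" and \<mu>: "\<mu> (\<mu> w) = w" for v w
    using K(2) M(2) by (auto simp: free_involution_def)
  obtain g where g: "Z2_map (realization_space M \<mu>) (realization_space K \<nu>) g" "carried M \<Psi> g"
    using carried_map_exists[OF M \<nu> \<Psi>] by blast
  have "Z2_homotopic (realization_space K \<nu>) (realization_space K \<nu>) (g \<circ> f) id"
    using carried_comp[OF K(1) \<Phi> f(2) g(2)] carried_id[OF K(1)] assms
    by (intro carried_homotopic[OF K \<nu> \<alpha>] Z2_map_comp[OF f(1) g(1)] Z2_map_id) blast+
  moreover have "Z2_homotopic (realization_space M \<mu>) (realization_space M \<mu>) (f \<circ> g) id"
    using carried_comp[OF M(1) \<Psi> g(2) f(2)] carried_id[OF M(1)] assms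
    by (intro carried_homotopic[OF M \<mu> \<beta>] Z2_map_comp[OF g(1) f(1)] Z2_map_id) blast+
  ultimately show ?thesis
    using f(1) g(1) unfolding Z2_homotopy_equivalence_def by blast
qed

section \<open>Contractibility by contiguous vertex maps\<close>

text \<open>Both images of a point lie in a common simplex, so the straight segment between them
  stays in the realization.\<close>

lemma contiguous_homotopic:
  assumes "finite_complex K" and "\<And>\<sigma>. \<sigma> \<in> K \<Longrightarrow> \<phi> ` \<sigma> \<union> \<psi> ` \<sigma> \<in> M"
  shows "homotopic_with_canon (\<lambda>_. True) (realization K) (realization M) (linear_ext \<phi>) (linear_ext \<psi>)"
proof (rule homotopic_with_linear)
  fix x assume x: "x \<in> realization K"
  define \<rho> where "\<rho> = \<phi> ` supp x \<union> \<psi> ` supp x"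
  have \<rho>: "\<rho> \<in> M" unfolding \<rho>_def using x by (intro assms(2)) (simp add: realization_iff[OF assms(1)])
  have "linear_ext \<phi> x \<in> realization {\<phi> ` supp x}" "linear_ext \<psi> x \<in> realization {\<psi> ` supp x}"
    by (rule linear_ext_in_realization[OF assms(1) x], simp)+
  moreover have "convex hull (basis_vec ` \<phi> ` supp x) \<subseteq> convex hull (basis_vec ` \<rho>)"
    "convex hull (basis_vec ` \<psi> ` supp x) \<subseteq> convex hull (basis_vec ` \<rho>)"
    by (intro hull_mono image_mono; simp add: \<rho>_def)+
  ultimately have "closed_segment (linear_ext \<phi> x) (linear_ext \<psi> x) \<subseteq> convex hull (basis_vec ` \<rho>)"
    by (intro closed_segment_subset convex_convex_hull) (auto simp: realization_def)
  then show "closed_segment (linear_ext \<phi> x) (linear_ext \<psi> x) \<subseteq> realization M"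
    using \<rho> by (auto simp: realization_def)
qed (rule continuous_on_linear_ext)+

text \<open>A chain of contiguous vertex maps from the identity to a constant; concatenating the
  straight-line homotopies contracts the complex. The conditions on \<open>\<phi> 0\<close> and
  \<open>\<phi> n\<close> concern only vertices that occur in \<open>K\<close>.\<close>

lemma contractible_realization:
  fixes \<phi> :: "nat \<Rightarrow> 'v \<Rightarrow> 'v"
  assumes K: "finite_complex K"
    and step: "\<And>i \<sigma>. i < n \<Longrightarrow> \<sigma> \<in> K \<Longrightarrow> \<phi> i ` \<sigma> \<union> \<phi> (Suc i) ` \<sigma> \<in> K"
    and first: "\<And>\<sigma> v. \<sigma> \<in> K \<Longrightarrow> v \<in> \<sigma> \<Longrightarrow> \<phi> 0 v = v"
    and last: "\<And>\<sigma> v. \<sigma> \<in> K \<Longrightarrow> v \<in> \<sigma> \<Longrightarrow> \<phi> n v = w"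
  shows "contractible (realization K)"
proof -
  let ?R = "realization K"
  have "homotopic_with_canon (\<lambda>_. True) ?R ?R (linear_ext (\<phi> 0)) (linear_ext (\<phi> i))" if "i \<le> n" for i
    using that
  proof (induction i)
    case 0
    have "linear_ext (\<phi> 0) x \<in> ?R" if "x \<in> ?R" for x
    proof (rule linear_ext_in_realization[OF K that])
      have s: "supp x \<in> K" using that by (simp add: realization_iff[OF K])
      then have "\<phi> 0 ` supp x = supp x" using first by (simp cong: image_cong)
      then show "\<phi> 0 ` supp x \<in> K" using s by simp
    qed
    then show ?case by (auto simp: continuous_on_linear_ext)
  next
    case (Suc i)
    then show ?case
      using contiguous_homotopic[OF K step, of i] homotopic_with_trans by fastforce
  qed
  then have *: "homotopic_with_canon (\<lambda>_. True) ?R ?R (linear_ext (\<phi> 0)) (linear_ext (\<phi> n))" by simp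
  have "homotopic_with_canon (\<lambda>_. True) ?R ?R id (\<lambda>_. basis_vec w)"
  proof (rule homotopic_with_eq[OF *])
    fix x assume "x \<in> topspace (top_of_set ?R)"
    then have x: "supp x \<in> K" "(\<Sum>u\<in>supp x. coord x u) = 1"
      by (auto simp: realization_iff[OF K])
    show "id x = linear_ext (\<phi> 0) x"
      using first[OF x(1)] by (simp add: linear_ext_def sum_basis_vec cong: sum.cong)
    show "basis_vec w = linear_ext (\<phi> n) x"
      using last[OF x(1)] x(2)
      by (simp add: linear_ext_def scaleR_sum_left[symmetric] cong: sum.cong)
  qed simp
  then show ?thesis unfolding contractible_def by blast
qed

section \<open>Order complexes\<close>

text \<open>Applied to the set of all simplices of a complex, this is the barycentric
  subdivision.\<close>

definition order_complex :: "'v set set \<Rightarrow> 'v set set set" where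
  "order_complex P = {c. c \<noteq> {} \<and> c \<subseteq> P \<and> (\<forall>s\<in>c. \<forall>t\<in>c. s \<subseteq> t \<or> t \<subseteq> s)}"

lemma finite_order_complex:
  assumes "finite P"
  shows "finite_complex (order_complex P)"
  unfolding finite_complex_def
proof (intro conjI ballI allI impI)
  show "finite (order_complex P)"
    by (rule finite_subset[of _ "Pow P"]) (use assms in \<open>auto simp: order_complex_def\<close>)
  fix c assume c: "c \<in> order_complex P"
  show "finite c" by (rule finite_subset[OF _ assms]) (use c in \<open>simp add: order_complex_def\<close>)
  show "c \<noteq> {}" using c by (simp add: order_complex_def)
  fix d assume "d \<subseteq> c" "d \<noteq> {}"
  then show "d \<in> order_complex P" using c by (auto simp: order_complex_def subset_iff[of d] subset_iff[of c])
qed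

lemma order_complex_mono: "P \<subseteq> Q \<Longrightarrow> order_complex P \<subseteq> order_complex Q"
  by (auto simp: order_complex_def)

text \<open>A finite chain contains its largest element, which is its union. So \<open>Union\<close>
  is a monotone map from chains to \<open>P\<close>, and dually \<open>Inter\<close> an
  order-reversing one.\<close>

lemma Union_chain_mem:
  assumes "finite P" and "c \<in> order_complex P"
  shows "\<Union>c \<in> c"
  using assms finite_subset[of c P]
  by (intro Union_in_chain[of _ P]) (auto simp: order_complex_def subset_chain_def)

lemma Inter_chain_mem:
  assumes "finite P" and "c \<in> order_complex P"
  shows "\<Inter>c \<in> c"
  using assms finite_subset[of c P]
  by (intro Inter_in_chain[of _ P]) (auto simp: order_complex_def subset_chain_def)

lemma image_order_complex:
  assumes "c \<in> order_complex P" and "\<And>s. s \<in> P \<Longrightarrow> s \<in> c \<Longrightarrow> \<nu> ` s \<in> Q"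
  shows "(`) \<nu> ` c \<in> order_complex Q"
  unfolding order_complex_def
proof (intro CollectI conjI ballI)
  show "(`) \<nu> ` c \<noteq> {}" using assms(1) by (simp add: order_complex_def)
  show "(`) \<nu> ` c \<subseteq> Q" using assms by (auto simp: order_complex_def)
  fix s t assume "s \<in> (`) \<nu> ` c" "t \<in> (`) \<nu> ` c"
  then obtain s' t' where st: "s' \<in> c" "t' \<in> c" "s = \<nu> ` s'" "t = \<nu> ` t'" by blast
  then have "s' \<subseteq> t' \<or> t' \<subseteq> s'" using assms(1) by (simp add: order_complex_def)
  then show "s \<subseteq> t \<or> t \<subseteq> s" using st(3,4) image_mono by blast
qed

text \<open>In an invariant chain, \<open>s\<close> and its image would be comparable finite sets of
  equal cardinality, hence equal.\<close>

lemma free_involution_order_complex: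
  assumes \<nu>: "\<And>v. \<nu> (\<nu> v) = v"
    and P: "\<And>s. s \<in> P \<Longrightarrow> finite s \<and> \<nu> ` s \<in> P \<and> \<nu> ` s \<noteq> s"
  shows "free_involution (order_complex P) (image \<nu>)"
  unfolding free_involution_def
proof (intro conjI allI ballI)
  show "\<nu> ` \<nu> ` s = s" for s by (simp add: image_image \<nu>)
  fix c assume c: "c \<in> order_complex P"
  show "(`) \<nu> ` c \<in> order_complex P" using image_order_complex[OF c] P by blast
  show "(`) \<nu> ` c \<noteq> c"
  proof
    assume eq: "(`) \<nu> ` c = c"
    obtain s where s: "s \<in> c" "s \<in> P" using c by (auto simp: order_complex_def)
    then have "\<nu> ` s \<in> c" using eq by blast
    then have "\<nu> ` s \<subseteq> s \<or> s \<subseteq> \<nu> ` s" using c s(1) by (auto simp: order_complex_def)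
    moreover have "card (\<nu> ` s) = card s"
      by (intro card_image inj_on_inverseI[where g = \<nu>] \<nu>)
    ultimately show False using P[OF s(2)] by (metis card_subset_eq finite_imageI)
  qed
qed

lemma free_involution_order_complex_faces:
  assumes "finite_complex L" and "free_involution L \<nu>"
  shows "free_involution (order_complex L) (image \<nu>)"
  using assms by (intro free_involution_order_complex)
    (simp_all add: free_involution_def finite_complex_def)

text \<open>Every simplex can be enlarged by the apex \<open>v\<close>, so the identity is
  contiguous to the constant map at \<open>v\<close>: a contraction in one step.\<close>

lemma contractible_cone:
  assumes "finite_complex K" and "\<And>\<sigma>. \<sigma> \<in> K \<Longrightarrow> insert v \<sigma> \<in> K"
  shows "contractible (realization K)"
proof (rule contractible_realization[OF assms(1), of 1 "\<lambda>i u. if i = 0 then u else v" v])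
  fix i :: nat and \<sigma> assume i: "i < 1" and \<sigma>: "\<sigma> \<in> K"
  have "(\<lambda>u. v) ` \<sigma> = {v}" using finite_complexD(2)[OF assms(1) \<sigma>] by auto
  then show "(\<lambda>u. if i = 0 then u else v) ` \<sigma> \<union> (\<lambda>u. if Suc i = 0 then u else v) ` \<sigma> \<in> K"
    using assms(2)[OF \<sigma>] i by simp
qed auto

lemma finite_full_simplex: "finite \<sigma> \<Longrightarrow> finite_complex (Pow \<sigma> - {{}})"
  unfolding finite_complex_def by (auto intro: finite_subset)

lemma contractible_full_simplex:
  assumes "finite \<sigma>" and "\<sigma> \<noteq> {}"
  shows "contractible (realization (Pow \<sigma> - {{}}))"
proof -
  obtain v where "v \<in> \<sigma>" using assms(2) by blast
  then show ?thesis by (intro contractible_cone[OF finite_full_simplex[OF assms(1)], of v]) auto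
qed

text \<open>An element comparable to all others can be added to every chain, so it is the apex of a
  cone.\<close>

lemma contractible_order_complex:
  assumes "finite P" and "t \<in> P" and "\<And>s. s \<in> P \<Longrightarrow> s \<subseteq> t \<or> t \<subseteq> s"
  shows "contractible (realization (order_complex P))"
proof (rule contractible_cone[OF finite_order_complex[OF assms(1)]])
  show "insert t c \<in> order_complex P" if "c \<in> order_complex P" for c
    using that assms(2,3) by (auto simp: order_complex_def subset_iff[of c])
qed

text \<open>The retraction \<open>f\<close> is applied to the elements of a chain one
  cardinality at a time, so that consecutive stages agree on all but one element.\<close>

lemma contractible_order_complex_retract:
  fixes P :: "'v set set"
  assumes P: "finite P" "\<And>s. s \<in> P \<Longrightarrow> finite s" and f: "\<And>s. s \<in> P \<Longrightarrow> f s \<in> P"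
    and mono: "\<And>s t. s \<in> P \<Longrightarrow> t \<in> P \<Longrightarrow> s \<subseteq> t \<Longrightarrow> f s \<subseteq> f t"
    and below: "\<And>s. s \<in> P \<Longrightarrow> f s \<subseteq> s" and t: "t \<in> P" "\<And>s. s \<in> P \<Longrightarrow> f s \<subseteq> t"
  shows "contractible (realization (order_complex P))"
proof -
  define N where "N = Suc (card (\<Union>P))"
  have N: "card s < N" if "s \<in> P" for s
    using that P by (auto simp: N_def less_Suc_eq_le intro!: card_mono)
  \<comment> \<open>Stage \<open>i \<le> N\<close> has applied \<open>f\<close> exactly to the
    elements of cardinality below \<open>i\<close>. As \<open>N\<close> exceeds all cardinalities in
    \<open>P\<close>, stage \<open>N\<close> is \<open>f\<close> itself; stage \<open>Suc N\<close>
    is the constant \<open>t\<close>.\<close>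
  define \<phi> where "\<phi> i s = (if i \<le> N then (if i \<le> card s then s else f s) else t)" for i s
  show ?thesis
  proof (rule contractible_realization[OF finite_order_complex[OF P(1)], of "Suc N" \<phi> t])
    show "\<phi> 0 s = s" for s by (simp add: \<phi>_def)
    show "\<phi> (Suc N) s = t" for s by (simp add: \<phi>_def)
    fix i c assume i: "i < Suc N" and c: "c \<in> order_complex P"
    have cP: "s \<in> P" if "s \<in> c" for s using c that by (auto simp: order_complex_def)
    have comp: "\<phi> a s \<subseteq> \<phi> b s' \<or> \<phi> b s' \<subseteq> \<phi> a s"
      if s: "s \<in> c" "s' \<in> c" "s \<subseteq> s'" and ab: "a \<in> {i, Suc i}" "b \<in> {i, Suc i}" for a b s s'
    proof (cases "i = N")
      case True
      have "card s < N" "card s' < N" using N cP s by auto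
      then show ?thesis
        using True ab cP[OF s(1)] cP[OF s(2)] mono[OF _ _ s(3)] t(2) by (auto simp: \<phi>_def)
    next
      case False
      then have ab': "a \<le> N" "b \<le> N" using i ab by auto
      note P' = cP[OF s(1)] cP[OF s(2)]
      have le: "f s \<subseteq> s" "f s' \<subseteq> s'" "f s \<subseteq> f s'" using below mono P' s(3) by auto
      \<comment> \<open>The critical case is a larger element already replaced. There
        \<open>card s < card s' < b\<close>, and since \<open>a\<close> and \<open>b\<close> differ
        by at most one, \<open>card s < a\<close>: the smaller element is replaced as well, and
        monotonicity of \<open>f\<close> applies.\<close>
      consider "s = s'" | "b \<le> card s'" | "s \<noteq> s'" "card s' < b" by linarith
      then show ?thesis
      proof cases
        case 1
        then show ?thesis using le ab' by (auto simp: \<phi>_def)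
      next
        case 2
        then show ?thesis using le ab' s(3) by (auto simp: \<phi>_def)
      next
        case 3
        then have "card s < card s'" using s(3) P(2)[OF P'(2)] by (intro psubset_card_mono) auto
        then show ?thesis using 3 le ab ab' by (auto simp: \<phi>_def)
      qed
    qed
    show "\<phi> i ` c \<union> \<phi> (Suc i) ` c \<in> order_complex P"
      unfolding order_complex_def
    proof (intro CollectI conjI ballI)
      show "\<phi> i ` c \<union> \<phi> (Suc i) ` c \<noteq> {}" using c by (auto simp: order_complex_def)
      show "\<phi> i ` c \<union> \<phi> (Suc i) ` c \<subseteq> P" using cP f t(1) by (auto simp: \<phi>_def)
      fix y z assume "y \<in> \<phi> i ` c \<union> \<phi> (Suc i) ` c" "z \<in> \<phi> i ` c \<union> \<phi> (Suc i) ` c"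
      then obtain a s b s' where "y = \<phi> a s" "z = \<phi> b s'" "s \<in> c" "s' \<in> c"
        "a \<in> {i, Suc i}" "b \<in> {i, Suc i}" by blast
      moreover from this have "s \<subseteq> s' \<or> s' \<subseteq> s" using c by (auto simp: order_complex_def)
      ultimately show "y \<subseteq> z \<or> z \<subseteq> y" using comp by metis
    qed
  qed
qed

lemma order_complex_nonempty: "t \<in> P \<Longrightarrow> order_complex P \<noteq> {}"
  by (auto simp: order_complex_def intro!: exI[of _ "{t}"])

section \<open>Standard carriers: lower sets, upper sets, full simplices, fibres\<close>

text \<open>The lower set of \<open>u \<sigma>\<close> has \<open>u \<sigma>\<close> as its largest
  element, so its order complex is a cone.\<close>

lemma acyclic_down_carrier:
  assumes "finite P" and "\<And>s. s \<in> P \<Longrightarrow> \<nu> ` s \<in> P"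
    and "\<And>\<sigma>. \<sigma> \<in> K \<Longrightarrow> u \<sigma> \<in> P"
    and "\<And>\<sigma>. \<sigma> \<in> K \<Longrightarrow> u (\<kappa> ` \<sigma>) = \<nu> ` u \<sigma>"
    and "\<And>\<rho> \<sigma>. \<rho> \<in> K \<Longrightarrow> \<sigma> \<in> K \<Longrightarrow> \<rho> \<subseteq> \<sigma> \<Longrightarrow> u \<rho> \<subseteq> u \<sigma>"
  shows "acyclic_carrier K \<kappa> (order_complex P) (image \<nu>) (\<lambda>\<sigma>. order_complex {s \<in> P. s \<subseteq> u \<sigma>})"
  unfolding acyclic_carrier_def
proof (intro ballI conjI impI)
  fix \<sigma> assume \<sigma>: "\<sigma> \<in> K"
  have fin: "finite {s \<in> P. s \<subseteq> u \<sigma>}" using assms(1) by simp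
  show "finite_complex (order_complex {s \<in> P. s \<subseteq> u \<sigma>})" by (rule finite_order_complex[OF fin])
  show "order_complex {s \<in> P. s \<subseteq> u \<sigma>} \<subseteq> order_complex P" by (intro order_complex_mono) auto
  show "order_complex {s \<in> P. s \<subseteq> u \<sigma>} \<noteq> {}"
    using assms(3)[OF \<sigma>] by (intro order_complex_nonempty[of "u \<sigma>"]) simp
  show "contractible (realization (order_complex {s \<in> P. s \<subseteq> u \<sigma>}))"
    using assms(3)[OF \<sigma>] by (intro contractible_order_complex[OF fin, of "u \<sigma>"]) auto
  show "(`) \<nu> ` c \<in> order_complex {s \<in> P. s \<subseteq> u (\<kappa> ` \<sigma>)}"
    if "c \<in> order_complex {s \<in> P. s \<subseteq> u \<sigma>}" for c
    using that by (rule image_order_complex) (use assms(2,4) \<sigma> in auto)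
  show "order_complex {s \<in> P. s \<subseteq> u \<rho>} \<subseteq> order_complex {s \<in> P. s \<subseteq> u \<sigma>}"
    if "\<rho> \<in> K" "\<rho> \<subseteq> \<sigma>" for \<rho>
    using assms(5)[OF that(1) \<sigma> that(2)] by (intro order_complex_mono) auto
qed

text \<open>Here \<open>u\<close> reverses inclusions, as intersections of chains do. Since
  \<open>u \<sigma>\<close> may lie outside \<open>P\<close>, the upper set can lack a least
  element, and its contractibility is a hypothesis.\<close>

lemma acyclic_up_carrier:
  assumes "finite P" and "\<And>s. s \<in> P \<Longrightarrow> \<nu> ` s \<in> P"
    and "\<And>\<sigma>. \<sigma> \<in> K \<Longrightarrow> contractible (realization (order_complex {s \<in> P. u \<sigma> \<subseteq> s}))"
    and "\<And>\<sigma>. \<sigma> \<in> K \<Longrightarrow> \<exists>s\<in>P. u \<sigma> \<subseteq> s"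
    and "\<And>\<sigma>. \<sigma> \<in> K \<Longrightarrow> u (\<kappa> ` \<sigma>) = \<nu> ` u \<sigma>"
    and "\<And>\<rho> \<sigma>. \<rho> \<in> K \<Longrightarrow> \<sigma> \<in> K \<Longrightarrow> \<rho> \<subseteq> \<sigma> \<Longrightarrow> u \<sigma> \<subseteq> u \<rho>"
  shows "acyclic_carrier K \<kappa> (order_complex P) (image \<nu>) (\<lambda>\<sigma>. order_complex {s \<in> P. u \<sigma> \<subseteq> s})"
  unfolding acyclic_carrier_def
proof (intro ballI conjI impI)
  fix \<sigma> assume \<sigma>: "\<sigma> \<in> K"
  have fin: "finite {s \<in> P. u \<sigma> \<subseteq> s}" using assms(1) by simp
  show "finite_complex (order_complex {s \<in> P. u \<sigma> \<subseteq> s})" by (rule finite_order_complex[OF fin])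
  show "order_complex {s \<in> P. u \<sigma> \<subseteq> s} \<subseteq> order_complex P" by (intro order_complex_mono) auto
  show "order_complex {s \<in> P. u \<sigma> \<subseteq> s} \<noteq> {}"
  proof -
    obtain s where "s \<in> P" "u \<sigma> \<subseteq> s" using assms(4)[OF \<sigma>] by blast
    then show ?thesis by (intro order_complex_nonempty[of s]) simp
  qed
  show "contractible (realization (order_complex {s \<in> P. u \<sigma> \<subseteq> s}))" by (rule assms(3)[OF \<sigma>])
  show "(`) \<nu> ` c \<in> order_complex {s \<in> P. u (\<kappa> ` \<sigma>) \<subseteq> s}"
    if "c \<in> order_complex {s \<in> P. u \<sigma> \<subseteq> s}" for c
    using that by (rule image_order_complex) (use assms(2,5) \<sigma> in auto)
  show "order_complex {s \<in> P. u \<rho> \<subseteq> s} \<subseteq> order_complex {s \<in> P. u \<sigma> \<subseteq> s}"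
    if "\<rho> \<in> K" "\<rho> \<subseteq> \<sigma>" for \<rho>
    using assms(6)[OF that(1) \<sigma> that(2)] by (intro order_complex_mono) auto
qed

lemma acyclic_simplex_carrier:
  assumes "finite_complex L"
    and "\<And>\<sigma>. \<sigma> \<in> K \<Longrightarrow> u \<sigma> \<in> L"
    and "\<And>\<sigma>. \<sigma> \<in> K \<Longrightarrow> u (\<kappa> ` \<sigma>) = \<nu> ` u \<sigma>"
    and "\<And>\<rho> \<sigma>. \<rho> \<in> K \<Longrightarrow> \<sigma> \<in> K \<Longrightarrow> \<rho> \<subseteq> \<sigma> \<Longrightarrow> u \<rho> \<subseteq> u \<sigma>"
  shows "acyclic_carrier K \<kappa> L \<nu> (\<lambda>\<sigma>. Pow (u \<sigma>) - {{}})"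
  unfolding acyclic_carrier_def
proof (intro ballI conjI impI)
  fix \<sigma> assume \<sigma>: "\<sigma> \<in> K"
  note u = finite_complexD[OF assms(1) assms(2)[OF \<sigma>]]
  show "finite_complex (Pow (u \<sigma>) - {{}})" by (rule finite_full_simplex[OF u(1)])
  show "Pow (u \<sigma>) - {{}} \<subseteq> L" using u(3) by blast
  show "Pow (u \<sigma>) - {{}} \<noteq> {}" using u(2) by blast
  show "contractible (realization (Pow (u \<sigma>) - {{}}))" by (rule contractible_full_simplex[OF u(1,2)])
  show "\<nu> ` \<rho> \<in> Pow (u (\<kappa> ` \<sigma>)) - {{}}" if "\<rho> \<in> Pow (u \<sigma>) - {{}}" for \<rho>
    using that assms(3)[OF \<sigma>] by auto
  show "Pow (u \<rho>) - {{}} \<subseteq> Pow (u \<sigma>) - {{}}" if "\<rho> \<in> K" "\<rho> \<subseteq> \<sigma>" for \<rho>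
    using assms(4)[OF that(1) \<sigma> that(2)] by blast
qed

text \<open>Monotonicity of \<open>q\<close> makes each fibre closed under nonempty faces, hence a
  subcomplex; its contractibility is the condition in Quillen's fibre lemma.\<close>

lemma acyclic_fibre_carrier:
  fixes q :: "'v set \<Rightarrow> 'w set"
  assumes "finite_complex K" and "\<And>\<tau>. \<tau> \<in> K \<Longrightarrow> \<kappa> ` \<tau> \<in> K"
    and "\<And>\<tau>. \<tau> \<in> K \<Longrightarrow> q (\<kappa> ` \<tau>) = \<nu> ` q \<tau>"
    and "\<And>\<rho> \<tau>. \<rho> \<subseteq> \<tau> \<Longrightarrow> q \<rho> \<subseteq> q \<tau>"
    and "\<And>x. x \<in> X \<Longrightarrow> contractible (realization {\<tau> \<in> K. q \<tau> \<subseteq> x})"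
    and "\<And>x. x \<in> X \<Longrightarrow> {\<tau> \<in> K. q \<tau> \<subseteq> x} \<noteq> {}"
    and "\<And>\<sigma>. \<sigma> \<in> N \<Longrightarrow> u \<sigma> \<in> X"
    and "\<And>\<sigma>. \<sigma> \<in> N \<Longrightarrow> u (\<eta> ` \<sigma>) = \<nu> ` u \<sigma>"
    and "\<And>\<rho> \<sigma>. \<rho> \<in> N \<Longrightarrow> \<sigma> \<in> N \<Longrightarrow> \<rho> \<subseteq> \<sigma> \<Longrightarrow> u \<rho> \<subseteq> u \<sigma>"
  shows "acyclic_carrier N \<eta> K \<kappa> (\<lambda>\<sigma>. {\<tau> \<in> K. q \<tau> \<subseteq> u \<sigma>})"
  unfolding acyclic_carrier_def
proof (intro ballI conjI impI)
  fix \<sigma> assume \<sigma>: "\<sigma> \<in> N"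
  show "finite_complex {\<tau> \<in> K. q \<tau> \<subseteq> u \<sigma>}"
    unfolding finite_complex_def
  proof (intro conjI ballI allI impI)
    show "finite {\<tau> \<in> K. q \<tau> \<subseteq> u \<sigma>}" using assms(1) by (simp add: finite_complex_def)
    fix \<tau> assume \<tau>: "\<tau> \<in> {\<tau> \<in> K. q \<tau> \<subseteq> u \<sigma>}"
    then show "finite \<tau>" "\<tau> \<noteq> {}" using finite_complexD(1,2)[OF assms(1)] by blast+
    fix \<rho> assume "\<rho> \<subseteq> \<tau>" "\<rho> \<noteq> {}"
    then show "\<rho> \<in> {\<tau> \<in> K. q \<tau> \<subseteq> u \<sigma>}"
      using \<tau> finite_complexD(3)[OF assms(1)] assms(4)[of \<rho> \<tau>] by blast
  qed
  show "{\<tau> \<in> K. q \<tau> \<subseteq> u \<sigma>} \<subseteq> K" by blast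
  show "{\<tau> \<in> K. q \<tau> \<subseteq> u \<sigma>} \<noteq> {}" by (rule assms(6)[OF assms(7)[OF \<sigma>]])
  show "contractible (realization {\<tau> \<in> K. q \<tau> \<subseteq> u \<sigma>})" by (rule assms(5)[OF assms(7)[OF \<sigma>]])
  show "\<kappa> ` \<tau> \<in> {\<tau> \<in> K. q \<tau> \<subseteq> u (\<eta> ` \<sigma>)}" if "\<tau> \<in> {\<tau> \<in> K. q \<tau> \<subseteq> u \<sigma>}" for \<tau>
    using that assms(2,3,8) \<sigma> by auto
  show "{\<tau> \<in> K. q \<tau> \<subseteq> u \<rho>} \<subseteq> {\<tau> \<in> K. q \<tau> \<subseteq> u \<sigma>}" if "\<rho> \<in> N" "\<rho> \<subseteq> \<sigma>" for \<rho>
    using assms(9)[OF that(1) \<sigma> that(2)] by blast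
qed

lemma Union_image_image: "\<Union> ((`) \<nu> ` c) = \<nu> ` \<Union>c"
  by blast

lemma Inter_image_image:
  assumes "\<And>v. \<nu> (\<nu> v) = v" and "c \<noteq> {}"
  shows "\<Inter> ((`) \<nu> ` c) = \<nu> ` \<Inter>c"
proof -
  have "x \<in> \<nu> ` s \<longleftrightarrow> \<nu> x \<in> s" for x s using assms(1) by (metis image_iff)
  then show ?thesis by (auto simp: set_eq_iff)
qed

section \<open>Subdivision, inclusion of posets, and face maps with contractible fibres\<close>

text \<open>A chain is carried to the full simplex on its largest element, and a simplex back to its
  own subdivision. The carrier of \<open>b\<close> is part of the conclusion so that
  \<open>b\<close> can later be compared with another map.\<close>

theorem subdivision_equivalence:
  assumes L: "finite_complex L" "free_involution L \<nu>"
  obtains b where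
    "Z2_homotopy_equivalence (realization_space (order_complex L) (image \<nu>)) (realization_space L \<nu>) b"
    and "carried (order_complex L) (\<lambda>c. Pow (\<Union>c) - {{}}) b"
proof -
  let ?S = "order_complex L"
  have \<nu>: "\<nu> (\<nu> v) = v" and \<nu>L: "\<And>\<sigma>. \<sigma> \<in> L \<Longrightarrow> \<nu> ` \<sigma> \<in> L" for v
    using L(2) by (auto simp: free_involution_def)
  have fin: "finite L" using L(1) by (simp add: finite_complex_def)
  note S = finite_order_complex[OF fin] free_involution_order_complex_faces[OF L]
  have U: "\<Union>c \<in> L" if "c \<in> ?S" for c
    using Union_chain_mem[OF fin that] that by (auto simp: order_complex_def)
  have 1: "acyclic_carrier ?S (image \<nu>) L \<nu> (\<lambda>c. Pow (\<Union>c) - {{}})"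
    by (rule acyclic_simplex_carrier[where u = Union, OF L(1) U Union_image_image Union_mono])
  have 2: "acyclic_carrier L \<nu> ?S (image \<nu>) (\<lambda>\<sigma>. order_complex {s \<in> L. s \<subseteq> \<sigma>})"
    by (rule acyclic_down_carrier[where u = "\<lambda>\<sigma>. \<sigma>", OF fin \<nu>L]) auto
  have 3: "acyclic_carrier ?S (image \<nu>) ?S (image \<nu>) (\<lambda>c. order_complex {s \<in> L. s \<subseteq> \<Union>c})"
    by (rule acyclic_down_carrier[where u = Union, OF fin \<nu>L U Union_image_image Union_mono])
  have 4: "acyclic_carrier L \<nu> L \<nu> (\<lambda>\<sigma>. Pow \<sigma> - {{}})"
    by (rule acyclic_simplex_carrier[where u = "\<lambda>\<sigma>. \<sigma>", OF L(1)]) auto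
  obtain b where b: "Z2_map (realization_space ?S (image \<nu>)) (realization_space L \<nu>) b"
      "carried ?S (\<lambda>c. Pow (\<Union>c) - {{}}) b"
    using carried_map_exists[OF S \<nu> 1] by blast
  have "Z2_homotopy_equivalence (realization_space ?S (image \<nu>)) (realization_space L \<nu>) b"
  proof (rule carried_equivalence[OF S L 1 2 3 4 _ _ _ _ b])
    show "c \<in> order_complex {s \<in> L. s \<subseteq> \<Union>c}" if "c \<in> ?S" for c
      using that by (auto simp: order_complex_def)
    show "\<sigma> \<in> Pow \<sigma> - {{}}" if "\<sigma> \<in> L" for \<sigma>
      using finite_complexD(2)[OF L(1) that] by blast
    show "order_complex {s \<in> L. s \<subseteq> \<sigma>} \<subseteq> order_complex {s \<in> L. s \<subseteq> \<Union>c}"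
      if "\<sigma> \<in> Pow (\<Union>c) - {{}}" for c \<sigma>
      using that by (intro order_complex_mono) auto
    show "Pow (\<Union>c) - {{}} \<subseteq> Pow \<sigma> - {{}}" if "c \<in> order_complex {s \<in> L. s \<subseteq> \<sigma>}" for c \<sigma>
      using that by (auto simp: order_complex_def)
  qed
  with b(2) show ?thesis by (rule that[rotated])
qed

text \<open>A chain is carried to the elements above its smallest member, taken in \<open>P\<close>
  or in \<open>Q\<close>. In \<open>Q\<close> this upper set is a cone; in \<open>P\<close> it is
  contractible by \<open>up\<close>. The inclusion \<open>id\<close> respects these
  carriers.\<close>

theorem order_complex_inclusion_equivalence:
  assumes "P \<subseteq> Q" and "finite Q" and \<nu>: "\<And>v. \<nu> (\<nu> v) = v"
    and P: "\<And>s. s \<in> P \<Longrightarrow> \<nu> ` s \<in> P"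
    and Q: "\<And>s. s \<in> Q \<Longrightarrow> finite s \<and> \<nu> ` s \<in> Q \<and> \<nu> ` s \<noteq> s"
    and up: "\<And>t. t \<in> Q \<Longrightarrow> contractible (realization (order_complex {s \<in> P. t \<subseteq> s}))"
    and cofinal: "\<And>t. t \<in> Q \<Longrightarrow> \<exists>s\<in>P. t \<subseteq> s"
  shows "Z2_homotopy_equivalence (realization_space (order_complex P) (image \<nu>))
    (realization_space (order_complex Q) (image \<nu>)) id"
proof -
  let ?P = "order_complex P" and ?Q = "order_complex Q"
  have finP: "finite P" using assms(1,2) by (rule finite_subset)
  have PQ: "?P \<subseteq> ?Q" by (rule order_complex_mono[OF assms(1)])
  have cP: "finite_complex ?P" "free_involution ?P (image \<nu>)"
    using finP \<nu> P Q assms(1)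
    by (auto intro!: finite_order_complex free_involution_order_complex)
  have cQ: "finite_complex ?Q" "free_involution ?Q (image \<nu>)"
    using assms(2) \<nu> Q by (auto intro!: finite_order_complex free_involution_order_complex)
  have IP: "\<Inter>c \<in> P" if "c \<in> ?P" for c
    using Inter_chain_mem[OF finP that] that by (auto simp: order_complex_def)
  have IQ: "\<Inter>c \<in> Q" if "c \<in> ?Q" for c
    using Inter_chain_mem[OF assms(2) that] that by (auto simp: order_complex_def)
  have equi: "\<Inter> ((`) \<nu> ` c) = \<nu> ` \<Inter>c" if "c \<in> ?Q" for c
    using that by (intro Inter_image_image \<nu>) (auto simp: order_complex_def)
  have upQ: "contractible (realization (order_complex {s \<in> Q. t \<subseteq> s}))" if "t \<in> Q" for t
    using assms(2) that by (intro contractible_order_complex[of _ t]) auto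
  have equi': "\<Inter> ((`) \<nu> ` c) = \<nu> ` \<Inter>c" if "c \<in> ?P" for c
    by (rule equi) (use PQ that in blast)
  have IPQ: "\<Inter>c \<in> Q" if "c \<in> ?P" for c using IP[OF that] assms(1) by blast
  have \<nu>Q: "\<nu> ` s \<in> Q" if "s \<in> Q" for s using Q[OF that] by blast
  have cofQ: "\<exists>s\<in>Q. t \<subseteq> s" if "t \<in> Q" for t using that by blast
  have 1: "acyclic_carrier ?P (image \<nu>) ?Q (image \<nu>) (\<lambda>c. order_complex {s \<in> Q. \<Inter>c \<subseteq> s})"
    by (rule acyclic_up_carrier[where u = Inter,
          OF assms(2) \<nu>Q upQ[OF IPQ] cofQ[OF IPQ] equi' Inter_anti_mono])
  have 2: "acyclic_carrier ?Q (image \<nu>) ?P (image \<nu>) (\<lambda>c. order_complex {s \<in> P. \<Inter>c \<subseteq> s})"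
    by (rule acyclic_up_carrier[where u = Inter,
          OF finP P up[OF IQ] cofinal[OF IQ] equi Inter_anti_mono])
  have 3: "acyclic_carrier ?P (image \<nu>) ?P (image \<nu>) (\<lambda>c. order_complex {s \<in> P. \<Inter>c \<subseteq> s})"
    by (rule acyclic_up_carrier[where u = Inter,
          OF finP P up[OF IPQ] cofinal[OF IPQ] equi' Inter_anti_mono])
  have 4: "acyclic_carrier ?Q (image \<nu>) ?Q (image \<nu>) (\<lambda>c. order_complex {s \<in> Q. \<Inter>c \<subseteq> s})"
    by (rule acyclic_up_carrier[where u = Inter,
          OF assms(2) \<nu>Q upQ[OF IQ] cofQ[OF IQ] equi Inter_anti_mono])
  have mem: "c \<in> order_complex {s \<in> R. \<Inter>c \<subseteq> s}" if "c \<in> order_complex R" for c and R :: "'a set set"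
    using that by (auto simp: order_complex_def)
  have sub: "order_complex {s \<in> R. \<Inter>d \<subseteq> s} \<subseteq> order_complex {s \<in> R. \<Inter>c \<subseteq> s}"
    if "d \<in> order_complex {s \<in> R'. \<Inter>c \<subseteq> s}" for c d and R R' :: "'a set set"
  proof (rule order_complex_mono)
    have "\<Inter>c \<subseteq> \<Inter>d" using that by (auto simp: order_complex_def subset_iff[of d])
    then show "{s \<in> R. \<Inter>d \<subseteq> s} \<subseteq> {s \<in> R. \<Inter>c \<subseteq> s}" by blast
  qed
  show ?thesis
  proof (rule carried_equivalence[OF cP cQ 1 2 3 4])
    show "Z2_map (realization_space ?P (image \<nu>)) (realization_space ?Q (image \<nu>)) id"
      using realization_mono[OF PQ] by (auto simp: Z2_map_realization_space)
    show "carried ?P (\<lambda>c. order_complex {s \<in> Q. \<Inter>c \<subseteq> s}) id"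
      using PQ by (intro carried_id[OF cP(1)] mem) blast
  qed (use mem sub in blast)+
qed

text \<open>An equivariant form of Quillen's fibre lemma for \<open>q\<close>. A simplex
  \<open>\<tau>\<close> is carried to the chains below \<open>q \<tau>\<close>, and a chain back to
  the fibre under its largest element.\<close>

theorem face_map_equivalence:
  fixes q :: "'v set \<Rightarrow> 'w set"
  assumes K: "finite_complex K" "free_involution K \<kappa>"
    and "finite X" and \<nu>: "\<And>v. \<nu> (\<nu> v) = v"
    and X: "\<And>s. s \<in> X \<Longrightarrow> finite s \<and> \<nu> ` s \<in> X \<and> \<nu> ` s \<noteq> s"
    and qX: "\<And>\<tau>. \<tau> \<in> K \<Longrightarrow> q \<tau> \<in> X"
    and equi: "\<And>\<tau>. \<tau> \<in> K \<Longrightarrow> q (\<kappa> ` \<tau>) = \<nu> ` q \<tau>"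
    and mono: "\<And>\<rho> \<tau>. \<rho> \<subseteq> \<tau> \<Longrightarrow> q \<rho> \<subseteq> q \<tau>"
    and fib: "\<And>x. x \<in> X \<Longrightarrow> contractible (realization {\<tau> \<in> K. q \<tau> \<subseteq> x})"
    and ne: "\<And>x. x \<in> X \<Longrightarrow> {\<tau> \<in> K. q \<tau> \<subseteq> x} \<noteq> {}"
  obtains a where
    "Z2_homotopy_equivalence (realization_space K \<kappa>) (realization_space (order_complex X) (image \<nu>)) a"
    and "carried K (\<lambda>\<tau>. order_complex {x \<in> X. x \<subseteq> q \<tau>}) a"
proof -
  let ?X = "order_complex X"
  have \<kappa>K: "\<And>\<sigma>. \<sigma> \<in> K \<Longrightarrow> \<kappa> ` \<sigma> \<in> K" and \<nu>X: "\<And>s. s \<in> X \<Longrightarrow> \<nu> ` s \<in> X"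
    using K(2) X by (auto simp: free_involution_def)
  have cX: "finite_complex ?X" "free_involution ?X (image \<nu>)"
    using assms(3) \<nu> X by (auto intro!: finite_order_complex free_involution_order_complex)
  have U: "\<Union>c \<in> X" if "c \<in> ?X" for c
    using Union_chain_mem[OF assms(3) that] that by (auto simp: order_complex_def)
  have inv: "\<nu> ` \<nu> ` s = s" for s by (simp add: image_image \<nu>)
  have 1: "acyclic_carrier K \<kappa> ?X (image \<nu>) (\<lambda>\<tau>. order_complex {x \<in> X. x \<subseteq> q \<tau>})"
    by (rule acyclic_down_carrier[where u = q, OF assms(3) \<nu>X qX equi mono])
  have 2: "acyclic_carrier ?X (image \<nu>) K \<kappa> (\<lambda>c. {\<tau> \<in> K. q \<tau> \<subseteq> \<Union>c})"
    by (rule acyclic_fibre_carrier[where q = q and u = Union, OF K(1) \<kappa>K equi mono fib ne U Union_image_image Union_mono])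
  have 3: "acyclic_carrier K \<kappa> K \<kappa> (\<lambda>\<sigma>. {\<tau> \<in> K. q \<tau> \<subseteq> q \<sigma>})"
    by (rule acyclic_fibre_carrier[where q = q and u = q, OF K(1) \<kappa>K equi mono fib ne qX equi mono])
  have 4: "acyclic_carrier ?X (image \<nu>) ?X (image \<nu>) (\<lambda>c. order_complex {x \<in> X. x \<subseteq> \<Union>c})"
    by (rule acyclic_down_carrier[where u = Union, OF assms(3) \<nu>X U Union_image_image Union_mono])
  obtain a where a: "Z2_map (realization_space K \<kappa>) (realization_space ?X (image \<nu>)) a"
      "carried K (\<lambda>\<tau>. order_complex {x \<in> X. x \<subseteq> q \<tau>}) a"
    using carried_map_exists[OF K inv 1] by blast
  have "Z2_homotopy_equivalence (realization_space K \<kappa>) (realization_space ?X (image \<nu>)) a"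
  proof (rule carried_equivalence[OF K cX 1 2 3 4 _ _ _ _ a])
    show "c \<in> order_complex {x \<in> X. x \<subseteq> \<Union>c}" if "c \<in> ?X" for c
      using that by (auto simp: order_complex_def)
    show "{\<tau> \<in> K. q \<tau> \<subseteq> \<Union>c} \<subseteq> {\<tau> \<in> K. q \<tau> \<subseteq> q \<sigma>}"
      if "c \<in> order_complex {x \<in> X. x \<subseteq> q \<sigma>}" for c \<sigma>
      using that by (auto simp: order_complex_def)
    show "order_complex {x \<in> X. x \<subseteq> q \<tau>} \<subseteq> order_complex {x \<in> X. x \<subseteq> \<Union>c}"
      if "\<tau> \<in> {\<tau> \<in> K. q \<tau> \<subseteq> \<Union>c}" for c \<tau>
      using that by (intro order_complex_mono) auto
  qed auto
  with a(2) show ?thesis by (rule that[rotated])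
qed

section \<open>The box complex\<close>

lemma parcs_no_loops:
  assumes "pair_graph G"
  shows "(v, v) \<notin> parcs G"
proof -
  interpret pair_graph G by fact
  show ?thesis using no_loops' by blast
qed

lemma pair_graph_imp_pseudo:
  assumes "pair_graph G"
  shows "pair_pseudo_graph G"
proof -
  interpret pair_graph G by fact
  show ?thesis by unfold_locales
qed

lemma shore_iff [simp]: "v \<in> shore c \<sigma> \<longleftrightarrow> (v, c) \<in> \<sigma>"
  by (simp add: shore_def)

context
  fixes G :: "'a pair_pre_digraph"
  assumes G: "pair_pseudo_graph G"
begin

lemma parcs_sym: "(u, v) \<in> parcs G \<Longrightarrow> (v, u) \<in> parcs G"
proof -
  interpret pair_pseudo_graph G by (rule G)
  show "(u, v) \<in> parcs G \<Longrightarrow> (v, u) \<in> parcs G" by (rule arcs_symmetric)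
qed

lemma parcs_pverts: "(u, v) \<in> parcs G \<Longrightarrow> u \<in> pverts G \<and> v \<in> pverts G"
proof -
  interpret pair_pseudo_graph G by (rule G)
  show "(u, v) \<in> parcs G \<Longrightarrow> u \<in> pverts G \<and> v \<in> pverts G"
    using in_arcsD1 in_arcsD2 by auto
qed

lemma finite_pverts: "finite (pverts G)"
proof -
  interpret pair_pseudo_graph G by (rule G)
  show ?thesis by (rule pair_finite_verts)
qed

text \<open>Deleting isolated vertices leaves the arcs unchanged, and a vertex with a neighbour
  survives. For an empty shore, any vertex of the nonempty \<open>\<sigma>\<close> witnesses that
  the common neighbours, then all remaining vertices, are nonempty.\<close>

lemma box_complex_iff:
  "\<sigma> \<in> box_complex G \<longleftrightarrow> \<sigma> \<noteq> {} \<and> joined G (shore White \<sigma>) (shore Black \<sigma>) \<and>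
     (\<forall>c. \<exists>w. \<forall>v\<in>shore c \<sigma>. (v, w) \<in> parcs G)"
proof -
  let ?H = "delete_isolated G"
  have nonisol: "u \<in> pverts ?H \<and> v \<in> pverts ?H" if "(u, v) \<in> parcs G" for u v
    using that parcs_pverts[OF that] parcs_sym[OF that]
    by (auto simp: delete_isolated_def Let_def neighbours_def)
  then have arcs: "parcs ?H = parcs G"
    by (auto simp: delete_isolated_def Let_def)
  have nb: "v \<in> pverts ?H \<Longrightarrow> \<exists>w. (v, w) \<in> parcs G" for v
    by (auto simp: delete_isolated_def Let_def neighbours_def)
  have joined: "joined ?H A B = joined G A B" for A B
    by (simp add: joined_def arcs)
  have cn: "common_neighbours ?H A \<noteq> {} \<longleftrightarrow> (\<exists>w\<in>pverts ?H. \<forall>v\<in>A. (v, w) \<in> parcs G)" for A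
    by (auto simp: common_neighbours_def neighbours_def arcs)
  have all: "(\<forall>c. P c) \<longleftrightarrow> P White \<and> P Black" for P by (metis colour.exhaust)
  show ?thesis
  proof
    assume "\<sigma> \<in> box_complex G"
    then show "\<sigma> \<noteq> {} \<and> joined G (shore White \<sigma>) (shore Black \<sigma>) \<and>
        (\<forall>c. \<exists>w. \<forall>v\<in>shore c \<sigma>. (v, w) \<in> parcs G)"
      unfolding all by (auto simp: box_complex_def Let_def joined cn)
  next
    assume \<sigma>: "\<sigma> \<noteq> {} \<and> joined G (shore White \<sigma>) (shore Black \<sigma>) \<and>
        (\<forall>c. \<exists>w. \<forall>v\<in>shore c \<sigma>. (v, w) \<in> parcs G)"
    have sub: "v \<in> pverts ?H" if "(v, c) \<in> \<sigma>" for v c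
      using \<sigma> that nonisol by (metis shore_iff)
    have "\<exists>w\<in>pverts ?H. \<forall>v\<in>shore c \<sigma>. (v, w) \<in> parcs G" for c
    proof (cases "shore c \<sigma> = {}")
      case True
      obtain v c' where "(v, c') \<in> \<sigma>" using \<sigma> by auto
      then show ?thesis using True sub by auto
    next
      case False
      then show ?thesis using \<sigma> nonisol by (metis all_not_in_conv)
    qed
    then show "\<sigma> \<in> box_complex G"
      using \<sigma> sub by (auto simp: box_complex_def Let_def joined cn)
  qed
qed

lemma finite_box_complex: "finite_complex (box_complex G)"
proof -
  have "(UNIV :: colour set) = {White, Black}" by (auto intro: colour.exhaust)
  then have "finite (UNIV :: colour set)" by (metis finite.emptyI finite_insert)
  then have fin: "finite (pverts G \<times> (UNIV :: colour set))" using finite_pverts by simp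
  have sub: "box_complex G \<subseteq> Pow (pverts G \<times> UNIV)"
    by (auto simp: box_complex_def Let_def delete_isolated_def)
  show ?thesis
    unfolding finite_complex_def
  proof (intro conjI ballI allI impI)
    show "finite (box_complex G)" by (rule finite_subset[OF sub]) (use fin in simp)
    fix \<sigma> assume \<sigma>: "\<sigma> \<in> box_complex G"
    show "finite \<sigma>" by (rule finite_subset[OF _ fin]) (use \<sigma> sub in blast)
    show "\<sigma> \<noteq> {}" using \<sigma> by (simp add: box_complex_iff)
    fix \<rho> assume "\<rho> \<subseteq> \<sigma>" "\<rho> \<noteq> {}"
    moreover from this have "shore c \<rho> \<subseteq> shore c \<sigma>" for c by (auto simp: shore_def)
    ultimately show "\<rho> \<in> box_complex G"
      using \<sigma> unfolding box_complex_iff joined_def by (meson subsetD)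
  qed
qed

text \<open>A vertex of an invariant simplex lies on both shores and would be adjacent to itself;
  this is where the absence of loops enters.\<close>

lemma free_involution_box_complex:
  assumes "\<And>v. (v, v) \<notin> parcs G"
  shows "free_involution (box_complex G) (map_prod id flip)"
  unfolding free_involution_def
proof (intro conjI allI ballI)
  show "map_prod id flip (map_prod id flip p) = p" for p :: "'a \<times> colour" by (cases p) simp
  fix \<sigma> assume \<sigma>: "\<sigma> \<in> box_complex G"
  show "map_prod id flip ` \<sigma> \<in> box_complex G" by (rule flip_box_complex[OF G \<sigma>])
  show "map_prod id flip ` \<sigma> \<noteq> \<sigma>"
  proof
    assume eq: "map_prod id flip ` \<sigma> = \<sigma>"
    obtain v c where "(v, c) \<in> \<sigma>" using \<sigma> by (auto simp: box_complex_iff)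
    moreover from this have "(v, flip c) \<in> \<sigma>" using eq by (metis id_apply image_eqI map_prod_simp)
    ultimately have "v \<in> shore White \<sigma>" "v \<in> shore Black \<sigma>" by (cases c; simp)+
    then show False using \<sigma> assms unfolding box_complex_iff joined_def by blast
  qed
qed

section \<open>The poset of simplices with both shores nonempty\<close>

definition two_sided :: "('a \<times> colour) set set" where
  "two_sided = {x \<in> box_complex G. \<forall>c. shore c x \<noteq> {}}"

text \<open>Each vertex of one shore is a common neighbour of the other shore, so the condition on
  common neighbours follows from the join.\<close>

lemma two_sided_iff:
  "x \<in> two_sided \<longleftrightarrow> (\<forall>c. shore c x \<noteq> {}) \<and> joined G (shore White x) (shore Black x)"
    (is "_ \<longleftrightarrow> ?R")
proof
  show ?R if "x \<in> two_sided" using that by (auto simp: two_sided_def box_complex_iff)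
  assume R: ?R
  then obtain u v where uv: "(u, White) \<in> x" "(v, Black) \<in> x" by (metis all_not_in_conv shore_iff)
  have "\<forall>w\<in>shore White x. (w, v) \<in> parcs G" "\<forall>w\<in>shore Black x. (w, u) \<in> parcs G"
    using R uv parcs_sym by (auto simp: joined_def)
  then have "\<exists>w. \<forall>v\<in>shore c x. (v, w) \<in> parcs G" for c
    by (cases c) blast+
  then show "x \<in> two_sided" using R uv by (auto simp: two_sided_def box_complex_iff)
qed

lemma two_sided_joined:
  assumes "x \<in> two_sided"
  shows "joined G (shore c x) (shore (flip c) x)"
  using assms parcs_sym by (cases c) (auto simp: two_sided_iff joined_def)

text \<open>An empty shore of \<open>t\<close> is filled with all common neighbours of the other
  shore. Every two-sided \<open>r\<close> above \<open>t\<close>, trimmed to \<open>t\<close> on the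
  shores that \<open>t\<close> meets, then fits inside \<open>s\<close>.\<close>

lemma two_sided_above:
  assumes t: "t \<in> box_complex G"
  obtains s where "s \<in> two_sided" and "t \<subseteq> s"
    and "\<And>r. r \<in> two_sided \<Longrightarrow> t \<subseteq> r \<Longrightarrow> {(v, c) \<in> r. shore c t \<noteq> {} \<longrightarrow> (v, c) \<in> t} \<subseteq> s"
proof -
  define s where "s = t \<union> {(v, c). shore c t = {} \<and> (\<forall>u\<in>shore (flip c) t. (u, v) \<in> parcs G)}"
  have tne: "shore White t \<noteq> {} \<or> shore Black t \<noteq> {}"
  proof -
    obtain v c where "(v, c) \<in> t" using t by (auto simp: box_complex_iff)
    then show ?thesis by (cases c) (auto simp: shore_def)
  qed
  have "s \<in> two_sided"
    unfolding two_sided_iff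
  proof (intro conjI allI)
    show "shore c s \<noteq> {}" for c
    proof (cases "shore c t = {}")
      case True
      obtain w where "\<forall>v\<in>shore (flip c) t. (v, w) \<in> parcs G"
        using t by (auto simp: box_complex_iff)
      then have "w \<in> shore c s" using True by (simp add: s_def)
      then show ?thesis by blast
    next
      case False
      then show ?thesis by (auto simp: s_def)
    qed
    show "joined G (shore White s) (shore Black s)"
      unfolding joined_def
    proof (intro ballI)
      fix u v assume uv: "u \<in> shore White s" "v \<in> shore Black s"
      have "(u, White) \<in> t \<or> shore White t = {} \<and> (\<forall>w\<in>shore Black t. (w, u) \<in> parcs G)"
        "(v, Black) \<in> t \<or> shore Black t = {} \<and> (\<forall>w\<in>shore White t. (w, v) \<in> parcs G)"
        using uv by (auto simp: s_def)
      then consider "u \<in> shore White t" "v \<in> shore Black t"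
        | "u \<in> shore White t" "(u, v) \<in> parcs G" | "v \<in> shore Black t" "(v, u) \<in> parcs G"
        using tne by auto
      then show "(u, v) \<in> parcs G"
      proof cases
        case 1
        then show ?thesis using t by (simp add: box_complex_iff joined_def)
      qed (use parcs_sym in auto)
    qed
  qed
  moreover have "{(v, c) \<in> r. shore c t \<noteq> {} \<longrightarrow> (v, c) \<in> t} \<subseteq> s"
    if r: "r \<in> two_sided" "t \<subseteq> r" for r
  proof clarify
    fix v c assume vc: "(v, c) \<in> r" "shore c t \<noteq> {} \<longrightarrow> (v, c) \<in> t"
    have "(u, v) \<in> parcs G" if "(u, flip c) \<in> t" for u
      using two_sided_joined[OF r(1), of "flip c"] that r(2) vc(1) by (auto simp: joined_def)
    then show "(v, c) \<in> s" using vc(2) by (auto simp: s_def)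
  qed
  ultimately show ?thesis by (intro that[of s]) (auto simp: s_def)
qed

text \<open>The trimming of \<open>two_sided_above\<close> is a monotone decreasing self-map
  \<open>f\<close> of the upper set, and its values lie below the single element
  \<open>m\<close>.\<close>

lemma contractible_two_sided_above:
  assumes t: "t \<in> box_complex G"
  shows "contractible (realization (order_complex {s \<in> two_sided. t \<subseteq> s}))"
proof -
  obtain m where m: "m \<in> two_sided" "t \<subseteq> m"
    and le: "\<And>r. r \<in> two_sided \<Longrightarrow> t \<subseteq> r \<Longrightarrow> {(v, c) \<in> r. shore c t \<noteq> {} \<longrightarrow> (v, c) \<in> t} \<subseteq> m"
    using two_sided_above[OF t] by blast
  define f where "f r = {(v, c) \<in> r. shore c t \<noteq> {} \<longrightarrow> (v, c) \<in> t}" for r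
  have sub: "two_sided \<subseteq> box_complex G" by (auto simp: two_sided_def)
  show ?thesis
  proof (rule contractible_order_complex_retract[where f = f and t = m])
    show "finite {s \<in> two_sided. t \<subseteq> s}"
      using finite_subset[OF sub] finite_box_complex by (simp add: finite_complex_def)
    show "finite s" if "s \<in> {s \<in> two_sided. t \<subseteq> s}" for s
      using that sub finite_complexD(1)[OF finite_box_complex] by blast
    show "f s \<subseteq> s" for s by (auto simp: f_def)
    show "f s \<subseteq> m" if "s \<in> {s \<in> two_sided. t \<subseteq> s}" for s
      using le[of s] that by (simp add: f_def)
    show "m \<in> {s \<in> two_sided. t \<subseteq> s}" using m by simp
    show "f s \<subseteq> f r" if "s \<subseteq> r" for s r using that by (auto simp: f_def)
    fix s assume s: "s \<in> {s \<in> two_sided. t \<subseteq> s}"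
    then have "t \<subseteq> f s" by (auto simp: f_def)
    moreover have "shore c (f s) \<noteq> {}" for c
    proof (cases "shore c t = {}")
      case True
      then have "shore c (f s) = shore c s" by (auto simp: f_def)
      then show ?thesis using s by (simp add: two_sided_iff)
    next
      case False
      then obtain v where "(v, c) \<in> t" by auto
      then have "v \<in> shore c (f s)" using \<open>t \<subseteq> f s\<close> by auto
      then show ?thesis by blast
    qed
    moreover have "joined G (shore White (f s)) (shore Black (f s))"
      using s by (auto simp: two_sided_iff joined_def f_def)
    ultimately show "f s \<in> {s \<in> two_sided. t \<subseteq> s}" by (simp add: two_sided_iff)
  qed
qed

end

section \<open>The box complex of the graph \<open>\<Omega>\<^sub>k(G)\<close>\<close>

definition alt :: "colour \<Rightarrow> nat \<Rightarrow> colour" where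
  "alt c i = (if even i then c else flip c)"

lemma alt_0 [simp]: "alt c 0 = c"
  and alt_Suc [simp]: "alt c (Suc i) = flip (alt c i)"
  and alt_flip [simp]: "alt (flip c) i = flip (alt c i)"
  by (simp_all add: alt_def)

text \<open>Adjacency for \<open>k = 2 * l + 1\<close>, with the index shifted to
  \<open>i < l\<close> to avoid truncated subtraction.\<close>

definition Omega_adj :: "nat \<Rightarrow> 'a pair_pre_digraph \<Rightarrow> 'a set list \<Rightarrow> 'a set list \<Rightarrow> bool" where
  "Omega_adj l G A B \<longleftrightarrow> A \<in> Omega_verts l G \<and> B \<in> Omega_verts l G \<and>
     (\<forall>i<l. A ! i \<subseteq> B ! Suc i \<and> B ! i \<subseteq> A ! Suc i) \<and> joined G (A ! l) (B ! l)"

lemma all_shift: "(\<forall>i\<in>{1..l}. P (i - 1) i) \<longleftrightarrow> (\<forall>i<l. P i (Suc i))" for l :: nat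
proof (intro iffI allI ballI impI)
  fix i assume "\<forall>i\<in>{1..l}. P (i - 1) i" "i < l"
  then show "P i (Suc i)" by (auto dest: bspec[where x = "Suc i"])
next
  fix i assume "\<forall>i<l. P i (Suc i)" "i \<in> {1..l}"
  then show "P (i - 1) i" by (cases i) auto
qed

lemma parcs_Omega: "(A, B) \<in> parcs (Omega (Suc (2 * l)) G) \<longleftrightarrow> Omega_adj l G A B"
  using all_shift[of l "\<lambda>i j. A ! i \<subseteq> B ! j \<and> B ! i \<subseteq> A ! j"]
  by (simp add: Omega_def Let_def Omega_adj_def)

lemma Omega_verts_joined:
  assumes "A \<in> Omega_verts l G" and "i < l"
  shows "joined G (A ! i) (A ! Suc i)"
  using assms all_shift[of l "\<lambda>i j. joined G (A ! i) (A ! j)"] by (simp add: Omega_verts_def)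

text \<open>The defining inclusions alternate between the two tuples as the index grows by one, so
  the parity of the distance decides in which tuple the chain ends.\<close>

lemma Omega_adj_subset:
  assumes "Omega_adj l G A B" and "i \<le> j" and "j \<le> l"
  shows "(even (i + j) \<longrightarrow> A ! i \<subseteq> A ! j) \<and> (odd (i + j) \<longrightarrow> A ! i \<subseteq> B ! j)"
  using assms(2,3)
proof (induction j rule: dec_induct)
  case (step j)
  then have "A ! j \<subseteq> B ! Suc j" "B ! j \<subseteq> A ! Suc j"
    using assms(1) by (auto simp: Omega_adj_def)
  then show ?case using step by auto
qed simp

text \<open>In a tuple with a neighbour, entries whose indices have the same parity are nested, which is
  why they get the same colour.\<close>

definition box_trace :: "nat \<Rightarrow> ('a set list \<times> colour) set \<Rightarrow> ('a \<times> colour) set" where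
  "box_trace l \<tau> = {(v, alt c i) | v A c i. (A, c) \<in> \<tau> \<and> i \<le> l \<and> v \<in> A ! i}"

lemma box_trace_mono: "\<rho> \<subseteq> \<tau> \<Longrightarrow> box_trace l \<rho> \<subseteq> box_trace l \<tau>"
  unfolding box_trace_def by blast

lemma box_trace_flip: "box_trace l (map_prod id flip ` \<tau>) = map_prod id flip ` box_trace l \<tau>"
proof -
  let ?F = "map_prod id flip"
  have inv: "?F ` ?F ` X = X" for X :: "('b \<times> colour) set"
    by (simp add: image_image map_prod_def case_prod_beta)
  have sub: "?F ` box_trace l \<tau> \<subseteq> box_trace l (?F ` \<tau>)" for \<tau> :: "('a set list \<times> colour) set"
  proof
    fix p assume "p \<in> ?F ` box_trace l \<tau>"
    then obtain v A c i where "p = (v, alt (flip c) i)" "(A, c) \<in> \<tau>" "i \<le> l" "v \<in> A ! i"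
      by (auto simp: box_trace_def)
    moreover from this have "(A, flip c) \<in> ?F ` \<tau>" by (auto simp: image_iff intro!: bexI[of _ "(A, c)"])
    ultimately show "p \<in> box_trace l (?F ` \<tau>)"
      unfolding box_trace_def
      by (intro CollectI exI[of _ v] exI[of _ A] exI[of _ "flip c"] exI[of _ i]) simp
  qed
  \<comment> \<open>The reverse inclusion is the one just proved, applied to the flipped
    set.\<close>
  have "?F ` box_trace l (?F ` \<tau>) \<subseteq> box_trace l \<tau>"
    using sub[of "?F ` \<tau>"] by (simp only: inv)
  then have "?F ` ?F ` box_trace l (?F ` \<tau>) \<subseteq> ?F ` box_trace l \<tau>" by (rule image_mono)
  then show ?thesis using sub[of \<tau>] by (simp only: inv)
qed

lemma box_trace_subset_iff:
  "box_trace l \<tau> \<subseteq> x \<longleftrightarrow> (\<forall>(A, c)\<in>\<tau>. \<forall>i\<le>l. A ! i \<subseteq> shore (alt c i) x)"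
  unfolding box_trace_def by (fastforce simp: subset_iff)

context
  fixes G :: "'a pair_pre_digraph" and l :: nat
  assumes G: "pair_pseudo_graph G"
begin

lemma Omega_adj_sym: "Omega_adj l G A B \<Longrightarrow> Omega_adj l G B A"
  using joined_sym[OF G] by (auto simp: Omega_adj_def)

text \<open>Below the last index, \<open>B ! i\<close> lies in \<open>A ! Suc i\<close>, to which
  \<open>A ! i\<close> is joined; at \<open>l\<close> the join is part of adjacency.\<close>

lemma Omega_adj_joined:
  assumes "Omega_adj l G A B" and "i \<le> l"
  shows "joined G (A ! i) (B ! i)"
proof (cases "i = l")
  case False
  then have "i < l" using assms(2) by simp
  then have "joined G (A ! i) (A ! Suc i)" "B ! i \<subseteq> A ! Suc i"
    using assms(1) Omega_verts_joined[of A l G i] by (auto simp: Omega_adj_def)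
  then show ?thesis unfolding joined_def by blast
qed (use assms in \<open>simp add: Omega_adj_def\<close>)

lemma Omega_adj_joined_even:
  assumes "Omega_adj l G A B" and "i \<le> l" "j \<le> l" "even (i + j)"
  shows "joined G (A ! i) (B ! j)"
proof (cases "i \<le> j")
  case True
  then have "A ! i \<subseteq> A ! j" using Omega_adj_subset[OF assms(1)] assms by blast
  then show ?thesis using Omega_adj_joined[OF assms(1,3)] unfolding joined_def by blast
next
  case False
  then have "B ! j \<subseteq> B ! i"
    using Omega_adj_subset[OF Omega_adj_sym[OF assms(1)], of j i] assms by (simp add: add.commute)
  then show ?thesis using Omega_adj_joined[OF assms(1,2)] unfolding joined_def by blast
qed

text \<open>The common neighbour \<open>B\<close> mediates: the entry of smaller index lies in the
  entry of \<open>B\<close> at the larger index, which is joined to the entry of the other tuple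
  there.\<close>

lemma Omega_adj_joined_odd:
  assumes "Omega_adj l G A B" and "Omega_adj l G A' B" and "i \<le> l" "j \<le> l" "odd (i + j)"
  shows "joined G (A ! i) (A' ! j)"
proof (cases "i \<le> j")
  case True
  then have "A ! i \<subseteq> B ! j" using Omega_adj_subset[OF assms(1)] assms by blast
  then show ?thesis
    using Omega_adj_joined[OF Omega_adj_sym[OF assms(2)] assms(4)] unfolding joined_def by blast
next
  case False
  then have "A' ! j \<subseteq> B ! i"
    using Omega_adj_subset[OF assms(2), of j i] assms by (simp add: add.commute)
  then show ?thesis using Omega_adj_joined[OF assms(1,3)] unfolding joined_def by blast
qed

lemma box_complex_Omega_iff:
  "\<tau> \<in> box_complex (Omega (Suc (2 * l)) G) \<longleftrightarrow> \<tau> \<noteq> {} \<and>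
     (\<forall>A B. (A, White) \<in> \<tau> \<longrightarrow> (B, Black) \<in> \<tau> \<longrightarrow> Omega_adj l G A B) \<and>
     (\<forall>c. \<exists>B. \<forall>A. (A, c) \<in> \<tau> \<longrightarrow> Omega_adj l G A B)"
  unfolding box_complex_iff[OF pair_pseudo_graph_Omega[OF G]] parcs_Omega joined_def
  by (simp add: Ball_def)

lemma box_complex_Omega_adj:
  assumes "\<tau> \<in> box_complex (Omega (Suc (2 * l)) G)" and "(A, c) \<in> \<tau>" and "(B, flip c) \<in> \<tau>"
  shows "Omega_adj l G A B"
  using assms Omega_adj_sym by (cases c) (auto simp: box_complex_Omega_iff)

lemma box_complex_Omega_nbr:
  assumes "\<tau> \<in> box_complex (Omega (Suc (2 * l)) G)" and "(A, c) \<in> \<tau>"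
  shows "\<exists>B. Omega_adj l G A B"
  using assms unfolding box_complex_Omega_iff by blast

text \<open>Entries of opposite colours come either from tuples of the same colour at indices of
  different parity, joined through a common neighbour, or from adjacent tuples at indices of equal
  parity. With \<open>0 < l\<close>, the entry at index 1 contains \<open>B ! 0\<close> and provides
  the second shore.\<close>

lemma box_trace_two_sided:
  assumes \<tau>: "\<tau> \<in> box_complex (Omega (Suc (2 * l)) G)" and "0 < l"
  shows "box_trace l \<tau> \<in> two_sided G"
  unfolding two_sided_iff[OF G]
proof (intro conjI allI)
  fix d
  obtain A c where A: "(A, c) \<in> \<tau>" using \<tau> by (auto simp: box_complex_Omega_iff)
  then obtain B where B: "Omega_adj l G A B" using box_complex_Omega_nbr[OF \<tau>] by blast
  have "A ! 0 \<noteq> {}" "B ! 0 \<noteq> {}" "B ! 0 \<subseteq> A ! 1"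
    using B \<open>0 < l\<close> by (auto simp: Omega_adj_def Omega_verts_def)
  then obtain u v where uv: "u \<in> A ! 0" "v \<in> A ! 1" by blast
  have "(u, c) \<in> box_trace l \<tau>" using A uv(1) by (force simp: box_trace_def)
  moreover have "(v, flip c) \<in> box_trace l \<tau>" unfolding box_trace_def
    using A uv(2) \<open>0 < l\<close>
    by (intro CollectI exI[of _ v] exI[of _ A] exI[of _ c] exI[of _ 1]) (simp add: alt_def)
  moreover have "d = c \<or> d = flip c" by (cases c; cases d) auto
  ultimately show "shore d (box_trace l \<tau>) \<noteq> {}" by (metis empty_iff shore_iff)
next
  show "joined G (shore White (box_trace l \<tau>)) (shore Black (box_trace l \<tau>))"
    unfolding joined_def
  proof (intro ballI)
    fix v w assume "v \<in> shore White (box_trace l \<tau>)" "w \<in> shore Black (box_trace l \<tau>)"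
    then obtain A c i A' c' j where A: "(A, c) \<in> \<tau>" "i \<le> l" "v \<in> A ! i" "alt c i = White"
      and A': "(A', c') \<in> \<tau>" "j \<le> l" "w \<in> A' ! j" "alt c' j = Black"
      by (auto simp: box_trace_def)
    show "(v, w) \<in> parcs G"
    proof (cases "c' = c")
      case True
      have "\<exists>B. \<forall>A. (A, c) \<in> \<tau> \<longrightarrow> Omega_adj l G A B"
        using \<tau> unfolding box_complex_Omega_iff by blast
      then obtain B where B: "\<And>A. (A, c) \<in> \<tau> \<Longrightarrow> Omega_adj l G A B" by blast
      have "odd (i + j)" using A(4) A'(4) True by (auto simp: alt_def split: if_splits)
      then have "joined G (A ! i) (A' ! j)"
        using Omega_adj_joined_odd[OF B B] A A' True by simp
      then show ?thesis using A A' by (simp add: joined_def)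
    next
      case False
      then have c': "c' = flip c" by (cases c; cases c') auto
      then have "even (i + j)" using A(4) A'(4) by (auto simp: alt_def split: if_splits)
      then have "joined G (A ! i) (A' ! j)"
        using Omega_adj_joined_even[OF box_complex_Omega_adj[OF \<tau> A(1)]] A A' c' by simp
      then show ?thesis using A A' by (simp add: joined_def)
    qed
  qed
qed

section \<open>Contractible fibres of the trace over a two-sided simplex\<close>

context
  fixes x assumes x: "x \<in> two_sided G"
begin

definition confined :: "colour \<Rightarrow> 'a set list \<Rightarrow> bool" where
  "confined c A \<longleftrightarrow> length A = l + 1 \<and> card (A ! 0) = 1 \<and> (\<forall>i\<le>l. A ! i \<subseteq> shore (alt c i) x)"

text \<open>Consecutive entries lie in opposite shores of \<open>x\<close>, which are joined, so the
  joins required of a vertex hold automatically.\<close>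

lemma confined_Omega_verts:
  assumes "confined c A"
  shows "A \<in> Omega_verts l G"
proof -
  have "joined G (A ! i) (A ! Suc i)" if "i < l" for i
    using two_sided_joined[OF G x, of "alt c i"] assms that
    by (auto simp: confined_def joined_def) (metis (no_types, lifting) Suc_leI alt_Suc less_imp_le shore_iff subsetD)
  then have "\<forall>i\<in>{1..l}. joined G (A ! (i - 1)) (A ! i)"
    using all_shift[of l "\<lambda>i j. joined G (A ! i) (A ! j)"] by simp
  moreover have "shore c x \<subseteq> pverts G" for c
  proof
    fix v assume v: "v \<in> shore c x"
    have "shore (flip c) x \<noteq> {}" using x unfolding two_sided_iff[OF G] by blast
    then obtain w where "w \<in> shore (flip c) x" by blast
    then show "v \<in> pverts G"
      using two_sided_joined[OF G x, of c] v parcs_pverts[OF G] unfolding joined_def by blast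
  qed
  then have "\<forall>i\<le>l. A ! i \<subseteq> pverts G" using assms unfolding confined_def by blast
  ultimately show ?thesis using assms by (simp add: confined_def Omega_verts_def)
qed

text \<open>The last entries lie in opposite shores and are therefore joined; only the inclusions
  remain as hypotheses.\<close>

lemma confined_adj:
  assumes "confined c A" and "confined (flip c) B"
    and "\<And>i. i < l \<Longrightarrow> A ! i \<subseteq> B ! Suc i \<and> B ! i \<subseteq> A ! Suc i"
  shows "Omega_adj l G A B"
proof -
  have "joined G (A ! l) (B ! l)"
    using two_sided_joined[OF G x, of "alt c l"] assms(1,2)
    unfolding confined_def joined_def by (metis alt_flip le_refl subsetD)
  then show ?thesis using assms confined_Omega_verts by (simp add: Omega_adj_def)
qed

text \<open>The cutoff \<open>m = Suc l\<close> changes no tuple of length \<open>l + 1\<close>, and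
  \<open>m = 1\<close> keeps just the starting vertex. With \<open>m = 0\<close> the entry at index
  0 might fail to be a singleton.\<close>

definition push :: "nat \<Rightarrow> 'a set list \<times> colour \<Rightarrow> 'a set list \<times> colour" where
  "push m = (\<lambda>(A, c). (map (\<lambda>i. if i < m then A ! i else shore (alt c i) x) [0..<l + 1], c))"

lemma push_eq: "push m (A, c) = (fst (push m (A, c)), c)"
  by (simp add: push_def)

lemma nth_push [simp]:
  "i \<le> l \<Longrightarrow> fst (push m (A, c)) ! i = (if i < m then A ! i else shore (alt c i) x)"
  by (simp add: push_def del: upt_Suc)

lemma confined_push:
  assumes "A \<in> Omega_verts l G" and "0 < m"
    and "\<And>i. i \<le> l \<Longrightarrow> i < m \<Longrightarrow> A ! i \<subseteq> shore (alt c i) x"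
  shows "confined c (fst (push m (A, c)))"
proof -
  have "length (fst (push m (A, c))) = l + 1" by (simp add: push_def)
  then show ?thesis using assms by (auto simp: confined_def Omega_verts_def)
qed

text \<open>If \<open>B ! Suc i\<close> is kept, then \<open>i < m\<close> because the cutoffs
  differ by at most one, so \<open>A ! i\<close> is kept too and the old inclusion survives. If it
  is replaced, it is a whole shore and contains the confined entry. The other inclusion is
  symmetric.\<close>

lemma push_adj:
  assumes adj: "Omega_adj l G A B" and m: "0 < m" "0 < n" "m \<le> n + 1" "n \<le> m + 1"
    and A: "\<And>i. i \<le> l \<Longrightarrow> i < m \<Longrightarrow> A ! i \<subseteq> shore (alt c i) x"
    and B: "\<And>i. i \<le> l \<Longrightarrow> i < n \<Longrightarrow> B ! i \<subseteq> shore (alt (flip c) i) x"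
  shows "Omega_adj l G (fst (push m (A, c))) (fst (push n (B, flip c)))"
proof (rule confined_adj)
  have AB: "A \<in> Omega_verts l G" "B \<in> Omega_verts l G" using adj by (auto simp: Omega_adj_def)
  show wA: "confined c (fst (push m (A, c)))" by (rule confined_push[OF AB(1) m(1) A])
  show wB: "confined (flip c) (fst (push n (B, flip c)))" by (rule confined_push[OF AB(2) m(2) B])
  fix i assume i: "i < l"
  have s: "A ! i \<subseteq> B ! Suc i" "B ! i \<subseteq> A ! Suc i" using adj i by (auto simp: Omega_adj_def)
  have "fst (push m (A, c)) ! i \<subseteq> fst (push n (B, flip c)) ! Suc i"
  proof (cases "Suc i < n")
    case True
    then show ?thesis using i s m by simp
  next
    case False
    then show ?thesis using i wA by (simp add: confined_def)
  qed
  moreover have "fst (push n (B, flip c)) ! i \<subseteq> fst (push m (A, c)) ! Suc i"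
  proof (cases "Suc i < m")
    case True
    then show ?thesis using i s m by simp
  next
    case False
    then show ?thesis using i wB unfolding confined_def
      by (metis alt_Suc alt_flip flip_flip less_imp_le_nat nth_push Suc_leI)
  qed
  ultimately show "fst (push m (A, c)) ! i \<subseteq> fst (push n (B, flip c)) ! Suc i \<and>
    fst (push n (B, flip c)) ! i \<subseteq> fst (push m (A, c)) ! Suc i" by blast
qed

abbreviation fibre :: "('a set list \<times> colour) set set" where
  "fibre \<equiv> {\<tau> \<in> box_complex (Omega (Suc (2 * l)) G). box_trace l \<tau> \<subseteq> x}"

text \<open>Lowering the cutoff by one is a contiguity inside the fibre, as \<open>push_adj\<close>
  tolerates mixing the two cutoffs.\<close>

lemma push_fibre:
  assumes \<tau>: "\<tau> \<in> fibre" and m: "0 < m" "m \<le> l"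
  shows "push (Suc m) ` \<tau> \<union> push m ` \<tau> \<in> fibre"
proof -
  define \<rho> where "\<rho> = push (Suc m) ` \<tau> \<union> push m ` \<tau>"
  have \<tau>': "\<tau> \<in> box_complex (Omega (Suc (2 * l)) G)" using \<tau> by simp
  have in_x: "A ! i \<subseteq> shore (alt c i) x" if "(A, c) \<in> \<tau>" "i \<le> l" for A c i
    using \<tau> that by (simp add: box_trace_subset_iff) blast
  have in_\<rho>: "\<exists>A n. (A, c) \<in> \<tau> \<and> V = fst (push n (A, c)) \<and> n \<in> {m, Suc m}"
    if "(V, c) \<in> \<rho>" for V c
    using that by (auto simp: \<rho>_def) (metis fst_conv push_eq snd_conv)+
  have "\<rho> \<in> box_complex (Omega (Suc (2 * l)) G)"
    unfolding box_complex_Omega_iff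
  proof (intro conjI allI impI)
    show "\<rho> \<noteq> {}" using \<tau> by (auto simp: \<rho>_def box_complex_Omega_iff)
    fix V W assume "(V, White) \<in> \<rho>" "(W, Black) \<in> \<rho>"
    then obtain A n B n' where
      A: "(A, White) \<in> \<tau>" "V = fst (push n (A, White))" "n \<in> {m, Suc m}" and
      B: "(B, Black) \<in> \<tau>" "W = fst (push n' (B, Black))" "n' \<in> {m, Suc m}"
      using in_\<rho> by metis
    have "Omega_adj l G A B" using box_complex_Omega_adj[OF \<tau>' A(1), of B] B(1) by simp
    then have "Omega_adj l G (fst (push n (A, White))) (fst (push n' (B, flip White)))"
      by (rule push_adj) (use m A B in_x[OF A(1)] in_x[OF B(1)] in auto)
    then show "Omega_adj l G V W" using A(2) B(2) by simp
  next
    fix c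
    have "\<exists>B. \<forall>A. (A, c) \<in> \<tau> \<longrightarrow> Omega_adj l G A B"
      using \<tau>' unfolding box_complex_Omega_iff by blast
    then obtain B where B: "\<And>A. (A, c) \<in> \<tau> \<Longrightarrow> Omega_adj l G A B" by blast
    have "Omega_adj l G V (fst (push m (B, flip c)))" if V: "(V, c) \<in> \<rho>" for V
    proof -
      obtain A n where A: "(A, c) \<in> \<tau>" "V = fst (push n (A, c))" "n \<in> {m, Suc m}"
        using in_\<rho>[OF V] by blast
      \<comment> \<open>The common neighbour \<open>B\<close> need not be a vertex of
        \<open>\<tau>\<close>, so its confinement is not given. Its entries below \<open>m\<close>
        lie in entries of \<open>A\<close>, which are confined; pushing replaces the rest.\<close>
      have "B ! i \<subseteq> shore (alt (flip c) i) x" if "i < m" for i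
      proof -
        have "B ! i \<subseteq> A ! Suc i" using B[OF A(1)] that m by (simp add: Omega_adj_def)
        then show ?thesis using in_x[OF A(1), of "Suc i"] that m by simp
      qed
      then have "Omega_adj l G (fst (push n (A, c))) (fst (push m (B, flip c)))"
        by (intro push_adj B A(1)) (use m A in_x[OF A(1)] in auto)
      then show ?thesis using A(2) by simp
    qed
    then show "\<exists>W. \<forall>V. (V, c) \<in> \<rho> \<longrightarrow> Omega_adj l G V W" by blast
  qed
  moreover have "box_trace l \<rho> \<subseteq> x"
    unfolding box_trace_subset_iff
  proof clarify
    fix V c i v assume V: "(V, c) \<in> \<rho>" and i: "i \<le> l" and v: "v \<in> V ! i"
    obtain A n where A: "(A, c) \<in> \<tau>" "V = fst (push n (A, c))" using in_\<rho>[OF V] by blast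
    then show "v \<in> shore (alt c i) x" using v i in_x[OF A(1) i] by (auto split: if_splits)
  qed
  ultimately show ?thesis by (simp add: \<rho>_def)
qed

text \<open>These tuples differ only in their starting vertex, given the colour, and together they
  span one simplex of the fibre.\<close>

definition tops :: "('a set list \<times> colour) set" where
  "tops = {(A, c). confined c A \<and> (\<forall>i\<in>{1..l}. A ! i = shore (alt c i) x)}"

lemma tops_adj:
  assumes "(A, c) \<in> tops" and "(B, flip c) \<in> tops"
  shows "Omega_adj l G A B"
proof (rule confined_adj)
  show "confined c A" "confined (flip c) B" using assms by (auto simp: tops_def)
  then show "A ! i \<subseteq> B ! Suc i \<and> B ! i \<subseteq> A ! Suc i" if "i < l" for i
    using assms that by (auto simp: tops_def confined_def)
qed

lemma tops_mem: "\<exists>A. (A, c) \<in> tops"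
proof -
  have "shore c x \<noteq> {}" using x unfolding two_sided_iff[OF G] by blast
  then obtain u where u: "u \<in> shore c x" by blast
  define A where "A = map (\<lambda>i. if i = 0 then {u} else shore (alt c i) x) [0..<l + 1]"
  have n: "A ! i = (if i = 0 then {u} else shore (alt c i) x)" if "i \<le> l" for i
    using that by (simp add: A_def del: upt_Suc)
  have "length A = l + 1" by (simp add: A_def)
  then have "(A, c) \<in> tops" using u by (auto simp: tops_def confined_def n)
  then show ?thesis by blast
qed

text \<open>Members of opposite colours are adjacent, and both colours occur, so any member of the
  opposite colour is the required common neighbour of a shore.\<close>

lemma subset_tops_fibre:
  assumes "\<rho> \<subseteq> tops" and "\<rho> \<noteq> {}"
  shows "\<rho> \<in> fibre"
proof -
  have "\<rho> \<in> box_complex (Omega (Suc (2 * l)) G)"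
    unfolding box_complex_Omega_iff
  proof (intro conjI allI impI)
    show "Omega_adj l G A B" if "(A, White) \<in> \<rho>" "(B, Black) \<in> \<rho>" for A B
      using tops_adj[of A White B] that assms(1) by auto
    show "\<exists>B. \<forall>A. (A, c) \<in> \<rho> \<longrightarrow> Omega_adj l G A B" for c
      using tops_mem[of "flip c"] tops_adj assms(1) by blast
  qed (rule assms(2))
  moreover have "box_trace l \<rho> \<subseteq> x"
    using assms(1) unfolding box_trace_subset_iff by (auto simp: tops_def confined_def)
  ultimately show ?thesis by simp
qed

lemma fibre_nonempty: "fibre \<noteq> {}"
proof -
  obtain A where "(A, White) \<in> tops" using tops_mem by blast
  then have "{(A, White)} \<in> fibre" by (intro subset_tops_fibre) auto
  then show ?thesis by blast
qed

lemma finite_fibre: "finite_complex fibre"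
proof -
  note K = finite_box_complex[OF pair_pseudo_graph_Omega[OF G, of "Suc (2 * l)"]]
  show ?thesis
    unfolding finite_complex_def
  proof (intro conjI ballI allI impI)
    show "finite fibre" using K by (simp add: finite_complex_def)
    fix \<tau> assume \<tau>: "\<tau> \<in> fibre"
    then show "finite \<tau>" "\<tau> \<noteq> {}" using finite_complexD(1,2)[OF K] by auto
    fix \<rho> assume "\<rho> \<subseteq> \<tau>" "\<rho> \<noteq> {}"
    then show "\<rho> \<in> fibre" using \<tau> finite_complexD(3)[OF K, of \<tau> \<rho>] box_trace_mono[of \<rho> \<tau> l] by auto
  qed
qed

text \<open>The entries of a vertex are replaced by the maximal admissible ones from the last to
  the first; only the starting vertex is kept.\<close>

lemma contractible_fibre:
  assumes "0 < l"
  shows "contractible (realization fibre)"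
proof -
  obtain W where W: "(W, White) \<in> tops" using tops_mem by blast
  \<comment> \<open>The cutoff descends from \<open>Suc l\<close>, the identity, to 1 at stage
    \<open>l\<close>; stage \<open>Suc l\<close> is constant.\<close>
  define \<phi> where "\<phi> i = (if i \<le> l then push (Suc l - i) else (\<lambda>_. (W, White)))" for i
  show ?thesis
  proof (rule contractible_realization[OF finite_fibre, where n = "Suc l" and \<phi> = \<phi>])
    fix \<tau> v assume \<tau>: "\<tau> \<in> fibre" and v: "v \<in> \<tau>"
    show "\<phi> (Suc l) v = (W, White)" by (simp add: \<phi>_def)
    obtain A c where A: "v = (A, c)" by (cases v)
    have "\<exists>B. Omega_adj l G A B" using box_complex_Omega_nbr \<tau> v A by blast
    then obtain B where "Omega_adj l G A B" by blast
    then have "length A = l + 1" by (simp add: Omega_adj_def Omega_verts_def)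
    then have "map (\<lambda>i. if i < Suc l then A ! i else shore (alt c i) x) [0..<l + 1] = A"
      by (intro nth_equalityI) (auto simp del: upt_Suc)
    then show "\<phi> 0 v = v" by (simp add: \<phi>_def A push_def del: upt_Suc)
  next
    fix i \<tau> assume i: "i < Suc l" and \<tau>: "\<tau> \<in> fibre"
    show "\<phi> i ` \<tau> \<union> \<phi> (Suc i) ` \<tau> \<in> fibre"
    proof (cases "i = l")
      case False
      then have "Suc l - i = Suc (l - i)" using i by simp
      then show ?thesis using push_fibre[OF \<tau>, of "l - i"] False i by (simp add: \<phi>_def)
    next
      case True
      \<comment> \<open>The final step collapses to \<open>W\<close> inside the simplex spanned by
        \<open>tops\<close>, since \<open>push 1\<close> takes values there.\<close>
      have "push 1 (A, c) \<in> tops" if A: "(A, c) \<in> \<tau>" for A c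
      proof -
        have "\<exists>B. Omega_adj l G A B" using box_complex_Omega_nbr \<tau> A by blast
        then have "A \<in> Omega_verts l G" by (auto simp: Omega_adj_def)
        moreover have "A ! i \<subseteq> shore (alt c i) x" if "i \<le> l" for i
          using \<tau> A that by (simp add: box_trace_subset_iff) blast
        ultimately have "confined c (fst (push 1 (A, c)))" by (intro confined_push) (assumption, simp, blast)
        then have "(fst (push 1 (A, c)), c) \<in> tops" by (auto simp: tops_def)
        then show ?thesis by (simp add: push_eq[symmetric])
      qed
      then have "\<phi> i ` \<tau> \<union> \<phi> (Suc i) ` \<tau> \<subseteq> tops" using True W by (auto simp: \<phi>_def)
      moreover have "\<tau> \<noteq> {}" using \<tau> by (simp add: box_complex_Omega_iff)
      ultimately show ?thesis by (intro subset_tops_fibre) auto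
    qed
  qed
qed

end

end

section \<open>The projection\<close>

lemma box_space_eq: "box_space G = realization_space (box_complex G) (map_prod id flip)"
  by (simp add: box_space_def realization_space_def)

text \<open>The projection is a homomorphism and would send a loop to a loop of
  \<open>G\<close>.\<close>

lemma Omega_no_loops:
  assumes "pair_graph G"
  shows "(A, A) \<notin> parcs (Omega k G)"
  using graph_hom_Omega_proj[OF pair_graph_imp_pseudo[OF assms], of k] parcs_no_loops[OF assms]
  by (auto simp: graph_hom_def)

lemma carried_subcomplex:
  assumes "carried M \<Phi> f" and "K \<subseteq> M"
  shows "carried K \<Phi> f"
  using assms realization_mono[OF assms(2)] by (auto simp: carried_def)

lemma Omega_proj_equivalence_pos:
  assumes "pair_graph G" and "0 < l"
  shows "Z2_homotopy_equivalence (box_space (Omega (Suc (2 * l)) G)) (box_space G) (box_map Omega_proj)"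
proof -
  note G = pair_graph_imp_pseudo[OF assms(1)]
  define K where "K = box_complex (Omega (Suc (2 * l)) G)"
  define L where "L = box_complex G"
  define X where "X = two_sided G"
  let ?\<kappa> = "map_prod id flip :: 'a set list \<times> colour \<Rightarrow> _"
  let ?\<nu> = "map_prod id flip :: 'a \<times> colour \<Rightarrow> _"
  let ?q = "box_trace l :: _ \<Rightarrow> ('a \<times> colour) set"
  have \<nu>: "?\<nu> (?\<nu> v) = v" for v by (cases v) simp
  have K: "finite_complex K" "free_involution K ?\<kappa>"
    unfolding K_def
    by (rule finite_box_complex free_involution_box_complex pair_pseudo_graph_Omega G
        Omega_no_loops assms(1))+
  have L: "finite_complex L" "free_involution L ?\<nu>"
    unfolding L_def
    by (rule finite_box_complex free_involution_box_complex G parcs_no_loops assms(1))+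
  have finL: "finite L" using L(1) by (simp add: finite_complex_def)
  have XL: "X \<subseteq> L" by (auto simp: X_def L_def two_sided_def[OF G])
  have finX: "finite X" by (rule finite_subset[OF XL finL])
  have Linv: "finite s \<and> ?\<nu> ` s \<in> L \<and> ?\<nu> ` s \<noteq> s" if "s \<in> L" for s
    using finite_complexD(1)[OF L(1) that] L(2) that by (auto simp: free_involution_def)
  have \<nu>X: "?\<nu> ` s \<in> X" if "s \<in> X" for s
    using Linv that XL by (auto simp: X_def L_def two_sided_def[OF G])
  have Xinv: "finite s \<and> ?\<nu> ` s \<in> X \<and> ?\<nu> ` s \<noteq> s" if "s \<in> X" for s
    using Linv[of s] \<nu>X that XL by auto
  have qX: "?q \<tau> \<in> X" if "\<tau> \<in> K" for \<tau>
    using box_trace_two_sided[OF G _ assms(2)] that by (simp add: X_def K_def)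
  have qL: "?q \<tau> \<in> L" if "\<tau> \<in> K" for \<tau> using qX[OF that] XL by blast
  obtain a where a: "Z2_homotopy_equivalence (realization_space K ?\<kappa>)
      (realization_space (order_complex X) (image ?\<nu>)) a"
    "carried K (\<lambda>\<tau>. order_complex {x \<in> X. x \<subseteq> ?q \<tau>}) a"
  proof (rule face_map_equivalence[where q = ?q, OF K finX \<nu> Xinv qX box_trace_flip box_trace_mono])
    fix x assume "x \<in> X"
    then have x: "x \<in> two_sided G" by (simp add: X_def)
    show "contractible (realization {\<tau> \<in> K. ?q \<tau> \<subseteq> x})"
      unfolding K_def by (rule contractible_fibre[OF G x assms(2)])
    show "{\<tau> \<in> K. ?q \<tau> \<subseteq> x} \<noteq> {}"
      unfolding K_def by (rule fibre_nonempty[OF G x])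
  qed
  have i: "Z2_homotopy_equivalence (realization_space (order_complex X) (image ?\<nu>))
      (realization_space (order_complex L) (image ?\<nu>)) id"
  proof (rule order_complex_inclusion_equivalence[OF XL finL \<nu> \<nu>X Linv])
    fix t assume "t \<in> L"
    then have t: "t \<in> box_complex G" by (simp add: L_def)
    show "contractible (realization (order_complex {s \<in> X. t \<subseteq> s}))"
      unfolding X_def by (rule contractible_two_sided_above[OF G t])
    show "\<exists>s\<in>X. t \<subseteq> s"
      using two_sided_above[OF G t] unfolding X_def by metis
  qed
  obtain b where b: "Z2_homotopy_equivalence (realization_space (order_complex L) (image ?\<nu>))
      (realization_space L ?\<nu>) b" "carried (order_complex L) (\<lambda>c. Pow (\<Union>c) - {{}}) b"
    using subdivision_equivalence[OF L] by blast
  have e: "Z2_homotopy_equivalence (realization_space K ?\<kappa>) (realization_space L ?\<nu>) (b \<circ> a)"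
    using Z2_homotopy_equivalence_comp[OF Z2_homotopy_equivalence_comp[OF a(1) i] b(1)] by simp
  have cb: "carried (order_complex X) (\<lambda>c. Pow (\<Union>c) - {{}}) b"
    by (rule carried_subcomplex[OF b(2) order_complex_mono[OF XL]])
  have "acyclic_carrier K ?\<kappa> (order_complex X) (image ?\<nu>) (\<lambda>\<tau>. order_complex {x \<in> X. x \<subseteq> ?q \<tau>})"
    by (rule acyclic_down_carrier[where u = ?q, OF finX \<nu>X qX box_trace_flip box_trace_mono])
  \<comment> \<open>The union of a chain below \<open>?q \<tau>\<close> stays inside
    \<open>?q \<tau>\<close>, so the carrier of \<open>b\<close> composes with that of
    \<open>a\<close> to full simplices.\<close>
  then have ce: "carried K (\<lambda>\<tau>. Pow (?q \<tau>) - {{}}) (b \<circ> a)"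
    by (rule carried_comp[OF K(1) _ a(2) cb]) (auto simp: order_complex_def)
  \<comment> \<open>The projection takes the entry at index 0, which keeps the colour of its tuple
    in the trace. So the image of a simplex is a face of its trace.\<close>
  have cp: "carried K (\<lambda>\<tau>. Pow (?q \<tau>) - {{}}) (box_map Omega_proj)"
    unfolding carried_def box_map_def
  proof
    fix x assume x: "x \<in> realization K"
    then have s: "supp x \<in> K" by (simp add: realization_iff[OF K(1)])
    have "map_prod Omega_proj id ` supp x \<subseteq> ?q (supp x)"
    proof
      fix p assume "p \<in> map_prod Omega_proj id ` supp x"
      then obtain A c where A: "(A, c) \<in> supp x" and p: "p = (Omega_proj A, c)" by auto
      then have "A \<in> Omega_verts l G"
        using box_complex_Omega_nbr[OF G _ A] s by (auto simp: K_def Omega_adj_def)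
      then have "Omega_proj A \<in> A ! 0" using Omega_proj_eq by auto
      then show "p \<in> ?q (supp x)"
        using A p unfolding box_trace_def
        by (intro CollectI exI[of _ "Omega_proj A"] exI[of _ A] exI[of _ c] exI[of _ 0]) simp
    qed
    moreover have "map_prod Omega_proj id ` supp x \<noteq> {}"
      using finite_complexD(2)[OF K(1) s] by blast
    ultimately show "linear_ext (map_prod Omega_proj id) x \<in> realization (Pow (?q (supp x)) - {{}})"
      by (intro linear_ext_in_realization[OF K(1) x]) simp
  qed
  have "acyclic_carrier K ?\<kappa> L ?\<nu> (\<lambda>\<tau>. Pow (?q \<tau>) - {{}})"
    by (rule acyclic_simplex_carrier[where u = ?q, OF L(1) qL box_trace_flip box_trace_mono])
  moreover have "Z2_map (realization_space K ?\<kappa>) (realization_space L ?\<nu>) (box_map Omega_proj)"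
    using Z2_map_box_map[OF graph_hom_Omega_proj[OF G]] by (simp add: box_space_eq K_def L_def)
  moreover have "Z2_map (realization_space K ?\<kappa>) (realization_space L ?\<nu>) (b \<circ> a)"
    using e by (simp add: Z2_homotopy_equivalence_def)
  ultimately have "Z2_homotopic (realization_space K ?\<kappa>) (realization_space L ?\<nu>)
      (box_map Omega_proj) (b \<circ> a)"
    using cp ce by (intro carried_homotopic[OF K \<nu>])
  with e have "Z2_homotopy_equivalence (realization_space K ?\<kappa>) (realization_space L ?\<nu>)
      (box_map Omega_proj)"
    by (rule Z2_homotopy_equivalence_homotopic)
  then show ?thesis by (simp add: box_space_eq K_def L_def)
qed

text \<open>For \<open>l = 0\<close> the trace of a single vertex has only one shore, so the fibre
  argument does not apply. Here the projection is undone by \<open>s\<close>, which renames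
  \<open>v\<close> as the tuple \<open>[{v}]\<close>.\<close>

lemma Omega_proj_equivalence_1:
  assumes "pair_graph G"
  shows "Z2_homotopy_equivalence (box_space (Omega 1 G)) (box_space G) (box_map Omega_proj)"
proof -
  note G = pair_graph_imp_pseudo[OF assms]
  have adj: "(A, B) \<in> parcs (Omega 1 G) \<longleftrightarrow> Omega_adj 0 G A B" for A B
    using parcs_Omega[of A B 0 G] by simp
  define s :: "'a \<Rightarrow> 'a set list" where "s v = [{v}]" for v
  have ps: "Omega_proj (s v) = v" for v by (simp add: Omega_proj_def s_def)
  have "s v \<in> Omega_verts 0 G" if "v \<in> pverts G" for v
    using that by (simp add: Omega_verts_def s_def)
  then have "graph_hom G (Omega 1 G) s"
    using parcs_pverts[OF G]
    by (auto simp: graph_hom_def adj Omega_adj_def) (auto simp: Omega_def joined_def s_def)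
  then have ms: "Z2_map (box_space G) (box_space (Omega 1 G)) (box_map s)"
    by (rule Z2_map_box_map)
  have mp: "Z2_map (box_space (Omega 1 G)) (box_space G) (box_map Omega_proj)"
    by (rule Z2_map_box_map[OF graph_hom_Omega_proj[OF G]])
  have "map_prod Omega_proj id \<circ> map_prod s id = (\<lambda>u :: 'a \<times> colour. u)" by (auto simp: ps)
  then have "(box_map Omega_proj \<circ> box_map s) x = id x" for x
    by (simp only: box_map_def comp_apply linear_ext_comp linear_ext_id id_apply)
  then have "box_map Omega_proj \<circ> box_map s = id" by (rule ext)
  then have 1: "Z2_homotopic (box_space G) (box_space G) (box_map Omega_proj \<circ> box_map s) id"
    using Z2_map_id by (simp add: Z2_homotopic_def)
  \<comment> \<open>This composite is the identity only on points supported on tuples of the form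
    \<open>[{v}]\<close>, so equality is claimed on the realization alone.\<close>
  have "(box_map s \<circ> box_map Omega_proj) x = id x" if x: "x \<in> realization (box_complex (Omega 1 G))" for x
  proof -
    note K = finite_box_complex[OF pair_pseudo_graph_Omega[OF G]]
    have "(map_prod s id \<circ> map_prod Omega_proj id) u = u" if u: "u \<in> supp x" for u
    proof -
      obtain A c where A: "u = (A, c)" by (cases u)
      have "supp x \<in> box_complex (Omega (Suc (2 * 0)) G)" using x by (simp add: realization_iff[OF K])
      then have "A \<in> Omega_verts 0 G"
        using box_complex_Omega_nbr[OF G] u A by (auto simp: Omega_adj_def)
      moreover from this have "length A = 1" by (simp add: Omega_verts_def)
      ultimately have "s (Omega_proj A) = A"
        using Omega_proj_eq[of A 0 G] by (cases A) (auto simp: s_def)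
      then show ?thesis by (simp add: A)
    qed
    then have "linear_ext (map_prod s id \<circ> map_prod Omega_proj id) x = x"
      by (simp add: linear_ext_def[of "_ \<circ> _"] sum_basis_vec cong: sum.cong)
    then show ?thesis by (simp add: box_map_def linear_ext_comp)
  qed
  then have 2: "Z2_homotopic (box_space (Omega 1 G)) (box_space (Omega 1 G))
      (box_map s \<circ> box_map Omega_proj) id"
    unfolding Z2_homotopic_def using Z2_map_comp[OF mp ms] Z2_map_id
    by (intro homotopic_with_equal) (auto simp: Z2_map_def box_space_def)
  show ?thesis using mp ms 1 2 unfolding Z2_homotopy_equivalence_def by blast
qed

theorem theorem1p1:
  fixes G :: "'a pair_pre_digraph" and k :: nat
  assumes "pair_graph G" and "odd k"
  shows "Z2_homotopy_equivalent (box_space G) (box_space (Omega k G)) \<and>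
         Z2_homotopy_equivalence (box_space (Omega k G)) (box_space G) (box_map Omega_proj)"
proof -
  obtain l where k: "k = Suc (2 * l)" using assms(2) by (auto elim: oddE)
  have "Z2_homotopy_equivalence (box_space (Omega k G)) (box_space G) (box_map Omega_proj)"
    using Omega_proj_equivalence_pos[OF assms(1), of l] Omega_proj_equivalence_1[OF assms(1)]
    by (cases "l = 0") (simp_all add: k)
  then show ?thesis using Z2_homotopy_equivalence_imp_equivalent_sym by blast
qed

end
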